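(* Let $G=A*B$, where each of $A,B$ is either an Artin-Tits group or a Coxeter group, with finite standard generating sets $S_A$ and $S_B$, regarded as a Shephard group generated by $S=S_A\sqcup S_B$. Then, for all $K,L,P\subseteq S$: (a) $\langle K\rangle\cap\langle L\rangle=\langle K\cap L\rangle$; (b) $\langle K\rangle\langle L\rangle\cap\langle K\rangle\langle P\rangle=\langle K\rangle(\langle L\rangle\cap\langle P\rangle)$; (c) the simplicial complex $\mathcal K(G,(G_i)_{i\in I})$ is a flag complex, where $I=\{1,\dots,|S|\}$, $S=\{s_i\mid i\in I\}$ and $G_i=\langle s_j\mid j\in I\setminus\{i\}\rangle$.
   Context: Notation: $(ab)_m$ is the alternating word $aba\cdots$ with $m$ factors. Coxeter groups: $\langle r_1,\dots,r_n\mid (r_ir_j)^{m_{i,j}}=1\rangle$ with $m_{i,i}=1$, $m_{i,j}=m_{j,i}\in\{2,3,\dots\}\cup\{\infty\}$ for $i\ne j$. Artin-Tits groups: $\langle a_1,\dots,a_n\mid (a_ia_j)_{m_{i,j}}=(a_ja_i)_{m_{i,j}}\ (i\ne j)\rangle$ (no relation if $m_{i,j}=\infty$). In both cases the listed generators are the standard ones. A Shephard group is a group presented by generators with prescribed orders (2, larger, or infinite) and relations $(ab)_{m}=(ba)_{m}$ between pairs; $A*B$ is the one with the relations of $A$ and of $B$ and no relation between $S_A$ and $S_B$. Products such as $\langle K\rangle\langle L\rangle$ are sets of products of elements. The coset complex $\mathcal K(G,(G_i)_{i\in I})$ is the abstract simplicial complex with vertices the left cosets $gG_i$, $g\in G$,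 $i\in I$ (cosets of different types $i$ are different vertices), a set $\{g_1G_{i_1},\dots,g_nG_{i_n}\}$ of vertices being a simplex iff $g_1G_{i_1}\cap\dots\cap g_nG_{i_n}\neq\emptyset$. A simplicial complex is a flag complex if every set of vertices that are pairwise joined by edges is a simplex. *)

theory Defs
  imports "HOL-Library.Extended_Nat" "HOL-Algebra.Generated_Groups"
begin

section \<open>Groups given by presentations\<close>

text \<open>A letter (x, True) stands for the generator x, and (x, False) for its formal inverse.
  A relation is a pair of words, read as an equation.\<close>

type_synonym 'a word = "('a \<times> bool) list"

definition words :: "'a set \<Rightarrow> 'a word set" where
  "words S = lists (S \<times> UNIV)"

inductive_set word_cong :: "'a set \<Rightarrow> ('a word \<times> 'a word) set \<Rightarrow> ('a word \<times> 'a word) set"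
  for S :: "'a set" and R :: "('a word \<times> 'a word) set" where
  rel: "\<lbrakk>(u, v) \<in> R; u \<in> words S; v \<in> words S\<rbrakk> \<Longrightarrow> (u, v) \<in> word_cong S R"
| cancel: "x \<in> S \<Longrightarrow> ([(x, b), (x, \<not> b)], []) \<in> word_cong S R"
| refl: "w \<in> words S \<Longrightarrow> (w, w) \<in> word_cong S R"
| sym: "(u, v) \<in> word_cong S R \<Longrightarrow> (v, u) \<in> word_cong S R"
| trans: "\<lbrakk>(u, v) \<in> word_cong S R; (v, w) \<in> word_cong S R\<rbrakk> \<Longrightarrow> (u, w) \<in> word_cong S R"
| ctxt: "\<lbrakk>(u, v) \<in> word_cong S R; p \<in> words S; q \<in> words S\<rbrakk>
    \<Longrightarrow> (p @ u @ q, p @ v @ q) \<in> word_cong S R"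

definition presented_group :: "'a set \<Rightarrow> ('a word \<times> 'a word) set \<Rightarrow> 'a word set monoid" where
  "presented_group S R =
    \<lparr>carrier = words S // word_cong S R,
     monoid.mult = (\<lambda>X Y. \<Union>u\<in>X. \<Union>v\<in>Y. word_cong S R `` {u @ v}),
     one = word_cong S R `` {[]}\<rparr>"

definition gen :: "'a set \<Rightarrow> ('a word \<times> 'a word) set \<Rightarrow> 'a \<Rightarrow> 'a word set" where
  "gen S R x = word_cong S R `` {[(x, True)]}"

definition subgroup_gen :: "'a set \<Rightarrow> ('a word \<times> 'a word) set \<Rightarrow> 'a set \<Rightarrow> 'a word set set" where
  "subgroup_gen S R K = generate (presented_group S R) (gen S R ` K)"


section \<open>Coxeter, Artin-Tits and Shephard groups\<close>

definition pos :: "'a list \<Rightarrow> 'a word" where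
  "pos xs = map (\<lambda>x. (x, True)) xs"

text \<open>The alternating word x y x ... with k factors.\<close>

fun alt :: "nat \<Rightarrow> 'a \<Rightarrow> 'a \<Rightarrow> 'a list" where
  "alt 0 x y = []"
| "alt (Suc k) x y = x # alt k y x"

definition coxeter_matrix :: "'a set \<Rightarrow> ('a \<Rightarrow> 'a \<Rightarrow> enat) \<Rightarrow> bool" where
  "coxeter_matrix S m \<longleftrightarrow>
    (\<forall>x\<in>S. m x x = 1) \<and> (\<forall>x\<in>S. \<forall>y\<in>S. m x y = m y x \<and> (x \<noteq> y \<longrightarrow> 2 \<le> m x y))"

definition coxeter_relations ::
  "'a set \<Rightarrow> ('a \<Rightarrow> 'a \<Rightarrow> enat) \<Rightarrow> ('a word \<times> 'a word) set" where
  "coxeter_relations S m =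
    {(pos (concat (replicate k [x, y])), []) | x y k. x \<in> S \<and> y \<in> S \<and> m x y = enat k}"

definition artin_relations ::
  "'a set \<Rightarrow> ('a \<Rightarrow> 'a \<Rightarrow> enat) \<Rightarrow> ('a word \<times> 'a word) set" where
  "artin_relations S m =
    {(pos (alt k x y), pos (alt k y x)) | x y k. x \<in> S \<and> y \<in> S \<and> x \<noteq> y \<and> m x y = enat k}"

definition shephard_relations ::
  "'a set \<Rightarrow> ('a \<Rightarrow> enat) \<Rightarrow> ('a \<Rightarrow> 'a \<Rightarrow> enat) \<Rightarrow> ('a word \<times> 'a word) set" where
  "shephard_relations S p m =
    {(pos (replicate k x), []) | x k. x \<in> S \<and> p x = enat k} \<union> artin_relations S m"

text \<open>The relations of the free product, on the disjoint union of the two generating sets.\<close>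

definition free_product_relations ::
  "('a word \<times> 'a word) set \<Rightarrow> ('b word \<times> 'b word) set
    \<Rightarrow> (('a + 'b) word \<times> ('a + 'b) word) set" where
  "free_product_relations R R' =
    map_prod (map (apfst Inl)) (map (apfst Inl)) ` R \<union>
    map_prod (map (apfst Inr)) (map (apfst Inr)) ` R'"


section \<open>Coset complexes and flag complexes\<close>

text \<open>An abstract simplicial complex is given by its set of simplices, the empty one included.
  All vertices of a coset complex occur in simplices, because cosets are nonempty.\<close>

definition abstract_complex :: "'v set set \<Rightarrow> bool" where
  "abstract_complex \<K> \<longleftrightarrow> {} \<in> \<K> \<and> (\<forall>\<sigma>\<in>\<K>. finite \<sigma> \<and> (\<forall>\<tau>\<subseteq>\<sigma>. \<tau> \<in> \<K>))"

definition flag_complex :: "'v set set \<Rightarrow> bool" where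
  "flag_complex \<K> \<longleftrightarrow> abstract_complex \<K> \<and>
    (\<forall>\<sigma>\<subseteq>\<Union>\<K>. (\<forall>u\<in>\<sigma>. \<forall>v\<in>\<sigma>. u \<noteq> v \<longrightarrow> {u, v} \<in> \<K>) \<longrightarrow> \<sigma> \<in> \<K>)"

definition coset_vertices ::
  "('g, 'h) monoid_scheme \<Rightarrow> 'i set \<Rightarrow> ('i \<Rightarrow> 'g set) \<Rightarrow> ('i \<times> 'g set) set" where
  "coset_vertices G I H = {(i, g <#\<^bsub>G\<^esub> H i) | i g. i \<in> I \<and> g \<in> carrier G}"

text \<open>The intersection is taken inside the group, so that the empty set is a simplex.\<close>

definition coset_complex ::
  "('g, 'h) monoid_scheme \<Rightarrow> 'i set \<Rightarrow> ('i \<Rightarrow> 'g set) \<Rightarrow> ('i \<times> 'g set) set set" where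
  "coset_complex G I H =
    {\<sigma>. finite \<sigma> \<and> \<sigma> \<subseteq> coset_vertices G I H \<and> carrier G \<inter> (\<Inter>v\<in>\<sigma>. snd v) \<noteq> {}}"


section \<open>Basic facts\<close>

lemma words_simps [simp]:
  "[] \<in> words S"
  "a # w \<in> words S \<longleftrightarrow> fst a \<in> S \<and> w \<in> words S"
  "u @ v \<in> words S \<longleftrightarrow> u \<in> words S \<and> v \<in> words S"
  "rev u \<in> words S \<longleftrightarrow> u \<in> words S"
  by (auto simp: words_def lists_eq_set mem_Times_iff)

lemma pos_simps [simp]:
  "pos [] = []" "pos (x # xs) = (x, True) # pos xs" "pos (xs @ ys) = pos xs @ pos ys"
  "pos (rev xs) = rev (pos xs)" "pos xs \<in> words S \<longleftrightarrow> set xs \<subseteq> S"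
  by (auto simp: pos_def rev_map words_def lists_eq_set)

lemma word_cong_words: "(u, v) \<in> word_cong S R \<Longrightarrow> u \<in> words S \<and> v \<in> words S"
  by (induction rule: word_cong.induct) auto

lemma equiv_word_cong: "equiv (words S) (word_cong S R)"
proof (rule equivI)
  show "refl_on (words S) (word_cong S R)"
    by (auto simp: refl_on_def dest: word_cong_words intro: word_cong.refl)
  show "sym (word_cong S R)" by (auto simp: sym_def intro: word_cong.sym)
  show "trans (word_cong S R)" by (auto simp: trans_def intro: word_cong.trans)
  show "word_cong S R \<subseteq> words S \<times> words S" by (auto dest: word_cong_words)
qed

lemma word_cong_append:
  assumes "(u, u') \<in> word_cong S R" "(v, v') \<in> word_cong S R"
  shows "(u @ v, u' @ v') \<in> word_cong S R"
proof -
  have "([] @ u @ v, [] @ u' @ v) \<in> word_cong S R"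
    using assms word_cong_words by (intro word_cong.ctxt) auto
  moreover have "(u' @ v @ [], u' @ v' @ []) \<in> word_cong S R"
    using assms word_cong_words by (intro word_cong.ctxt) auto
  ultimately show ?thesis by (auto intro: word_cong.trans)
qed

lemma presented_group_mult:
  assumes "u \<in> words S" "v \<in> words S"
  shows "(word_cong S R `` {u}) \<otimes>\<^bsub>presented_group S R\<^esub> (word_cong S R `` {v}) =
    word_cong S R `` {u @ v}"
proof -
  have "(\<Union>u'\<in>word_cong S R `` {u}. \<Union>v'\<in>word_cong S R `` {v}. word_cong S R `` {u' @ v'}) =
    word_cong S R `` {u @ v}"
  proof -
    have "word_cong S R `` {u' @ v'} = word_cong S R `` {u @ v}"
      if "u' \<in> word_cong S R `` {u}" "v' \<in> word_cong S R `` {v}" for u' v'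
      using that equiv_class_eq[OF equiv_word_cong word_cong_append] by fastforce
    moreover have "u \<in> word_cong S R `` {u}" "v \<in> word_cong S R `` {v}"
      using assms by (auto intro: word_cong.refl)
    ultimately show ?thesis by blast
  qed
  then show ?thesis by (simp add: presented_group_def)
qed

definition word_inv :: "'a word \<Rightarrow> 'a word" where
  "word_inv w = rev (map (apsnd Not) w)"

lemma word_inv_words [simp]: "word_inv w \<in> words S \<longleftrightarrow> w \<in> words S"
  by (force simp: word_inv_def words_def lists_eq_set)

lemma word_inv_cancel: "w \<in> words S \<Longrightarrow> (word_inv w @ w, []) \<in> word_cong S R"
proof (induction w)
  case Nil
  then show ?case by (simp add: word_inv_def word_cong.refl)
next
  case (Cons a w)
  obtain x b where a: "a = (x, b)" by (cases a)
  have w: "w \<in> words S" "word_inv w \<in> words S" "x \<in> S" using Cons.prems a by auto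
  have "([(x, \<not> b), (x, \<not> \<not> b)], []) \<in> word_cong S R"
    using w by (intro word_cong.cancel)
  then have "(word_inv w @ [(x, \<not> b), (x, b)] @ w, word_inv w @ [] @ w) \<in> word_cong S R"
    using w by (intro word_cong.ctxt) auto
  then have "(word_inv (a # w) @ a # w, word_inv w @ w) \<in> word_cong S R"
    by (simp add: a word_inv_def)
  then show ?case using Cons.IH w by (blast intro: word_cong.trans)
qed

lemma group_presented_group: "group (presented_group S R)"
proof (rule groupI)
  let ?G = "presented_group S R" and ?c = "\<lambda>w. word_cong S R `` {w}"
  have carr: "X \<in> carrier ?G \<longleftrightarrow> (\<exists>w\<in>words S. X = ?c w)" for X
    by (auto simp: presented_group_def quotient_def)
  have one: "\<one>\<^bsub>?G\<^esub> = ?c []" by (simp add: presented_group_def)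
  show "\<one>\<^bsub>?G\<^esub> \<in> carrier ?G" unfolding carr one by (rule bexI[of _ "[]"]) auto
  fix X assume X: "X \<in> carrier ?G"
  then obtain u where u: "u \<in> words S" "X = ?c u" by (auto simp: carr)
  show "\<one>\<^bsub>?G\<^esub> \<otimes>\<^bsub>?G\<^esub> X = X" using u by (simp add: one presented_group_mult)
  have "?c (word_inv u @ u) = ?c []"
    using u by (intro equiv_class_eq[OF equiv_word_cong] word_inv_cancel)
  then have "?c (word_inv u) \<otimes>\<^bsub>?G\<^esub> X = \<one>\<^bsub>?G\<^esub>"
    using u by (simp add: one presented_group_mult)
  moreover have "?c (word_inv u) \<in> carrier ?G"
    unfolding carr using u by (intro bexI[of _ "word_inv u"]) auto
  ultimately show "\<exists>Y\<in>carrier ?G. Y \<otimes>\<^bsub>?G\<^esub> X = \<one>\<^bsub>?G\<^esub>" by blast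
  fix Y assume "Y \<in> carrier ?G"
  then obtain v where v: "v \<in> words S" "Y = ?c v" by (auto simp: carr)
  show "X \<otimes>\<^bsub>?G\<^esub> Y \<in> carrier ?G"
    using u v by (auto simp: carr presented_group_mult intro!: bexI[of _ "u @ v"])
  fix Z assume "Z \<in> carrier ?G"
  then obtain w where w: "w \<in> words S" "Z = ?c w" by (auto simp: carr)
  show "X \<otimes>\<^bsub>?G\<^esub> Y \<otimes>\<^bsub>?G\<^esub> Z = X \<otimes>\<^bsub>?G\<^esub> (Y \<otimes>\<^bsub>?G\<^esub> Z)"
    using u v w by (simp add: presented_group_mult)
qed


section \<open>Free products of Coxeter and Artin-Tits groups as Shephard groups\<close>

lemma word_cong_leI:
  assumes "\<And>u v. \<lbrakk>(u, v) \<in> R; u \<in> words S; v \<in> words S\<rbrakk> \<Longrightarrow> (u, v) \<in> word_cong S R'"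
  shows "word_cong S R \<subseteq> word_cong S R'"
proof -
  have "(u, v) \<in> word_cong S R'" if "(u, v) \<in> word_cong S R" for u v
    using that by induction (auto intro: assms word_cong.intros)
  then show ?thesis by auto
qed

lemma presented_group_cong:
  assumes "word_cong S R = word_cong S R'"
  shows "presented_group S R = presented_group S R'" "gen S R = gen S R'"
  using assms by (simp_all add: presented_group_def gen_def fun_eq_iff)

lemma set_alt: "set (alt k x y) \<subseteq> {x, y}"
  by (induction k arbitrary: x y) auto

lemma alt_rev_alt: "alt k x y @ rev (alt k y x) = concat (replicate k [x, y])"
proof (induction k arbitrary: x y)
  case (Suc k)
  have swap: "x # concat (replicate k [y, x]) @ [y] = concat (replicate (Suc k) [x, y])" for k
    by (induction k) auto
  have "alt (Suc k) x y @ rev (alt (Suc k) y x) = x # (alt k y x @ rev (alt k x y)) @ [y]"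
    by simp
  also have "\<dots> = concat (replicate (Suc k) [x, y])"
    by (simp only: Suc.IH swap)
  finally show ?case .
qed simp

lemma pos_rev_cancel:
  assumes "\<And>x. x \<in> S \<Longrightarrow> (pos [x, x], []) \<in> word_cong S R" and "set xs \<subseteq> S"
  shows "(pos xs @ pos (rev xs), []) \<in> word_cong S R"
  using assms(2)
proof (induction xs rule: rev_induct)
  case Nil
  then show ?case by (simp add: word_cong.refl)
next
  case (snoc x xs)
  have "(pos xs @ pos [x, x] @ pos (rev xs), pos xs @ [] @ pos (rev xs)) \<in> word_cong S R"
    using snoc.prems by (intro word_cong.ctxt assms(1)) auto
  with snoc show ?case by (auto intro: word_cong.trans)
qed

lemma braid_iff_power:
  assumes inv: "\<And>x. x \<in> S \<Longrightarrow> (pos [x, x], []) \<in> word_cong S R" and xy: "x \<in> S" "y \<in> S"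
  shows "(pos (alt k x y), pos (alt k y x)) \<in> word_cong S R \<longleftrightarrow>
    (pos (concat (replicate k [x, y])), []) \<in> word_cong S R"
proof -
  define u v where "u = pos (alt k x y)" and "v = pos (alt k y x)"
  have S: "set (alt k x y) \<subseteq> S" "set (alt k y x) \<subseteq> S"
    using set_alt[of k x y] set_alt[of k y x] xy by auto
  have w: "u \<in> words S" "v \<in> words S" using S by (simp_all add: u_def v_def)
  have v1: "(v @ rev v, []) \<in> word_cong S R" and v2: "(rev v @ v, []) \<in> word_cong S R"
    using pos_rev_cancel[OF inv, of "alt k y x"] pos_rev_cancel[OF inv, of "rev (alt k y x)"] S
    by (simp_all add: v_def)
  have uv: "pos (concat (replicate k [x, y])) = u @ rev v"
    unfolding u_def v_def alt_rev_alt[symmetric] by simp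
  show ?thesis unfolding uv u_def[symmetric] v_def[symmetric]
  proof
    assume "(u, v) \<in> word_cong S R"
    then have "(u @ rev v, v @ rev v) \<in> word_cong S R"
      using w by (intro word_cong_append word_cong.refl) auto
    then show "(u @ rev v, []) \<in> word_cong S R" using v1 by (rule word_cong.trans)
  next
    assume "(u @ rev v, []) \<in> word_cong S R"
    then have "((u @ rev v) @ v, [] @ v) \<in> word_cong S R"
      using w by (intro word_cong_append word_cong.refl) auto
    moreover have "(u @ (rev v @ v), u @ []) \<in> word_cong S R"
      using v2 w by (intro word_cong_append word_cong.refl) auto
    ultimately show "(u, v) \<in> word_cong S R"
      by (auto intro: word_cong.trans word_cong.sym)
  qed
qed

lemma coxeter_relations_shephard:
  assumes m: "coxeter_matrix S m"
  shows "word_cong S (coxeter_relations S m) = word_cong S (shephard_relations S (\<lambda>_. 2) m)"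
    (is "word_cong S ?C = word_cong S ?H")
proof
  have two: "(2 :: enat) = enat k \<longleftrightarrow> k = 2" for k
    by (auto simp: numeral_eq_enat)
  have C2: "(pos [x, x], []) \<in> word_cong S ?C" if "x \<in> S" for x
  proof (rule word_cong.rel)
    have "m x x = enat 1" using that m by (auto simp: coxeter_matrix_def one_enat_def)
    then show "(pos [x, x], []) \<in> ?C" unfolding coxeter_relations_def
      using that by (auto intro!: exI[of _ x] exI[of _ "1::nat"])
  qed (use that in auto)
  have H2: "(pos [x, x], []) \<in> word_cong S ?H" if "x \<in> S" for x
  proof (rule word_cong.rel)
    show "(pos [x, x], []) \<in> ?H" unfolding shephard_relations_def two
      using that by (auto simp: numeral_2_eq_2 intro!: exI[of _ x])
  qed (use that in auto)
  show "word_cong S ?C \<subseteq> word_cong S ?H"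
  proof (rule word_cong_leI)
    fix u v assume "(u, v) \<in> ?C"
    then obtain x y k where k: "x \<in> S" "y \<in> S" "m x y = enat k" "v = []"
      "u = pos (concat (replicate k [x, y]))" by (auto simp: coxeter_relations_def)
    show "(u, v) \<in> word_cong S ?H"
    proof (cases "x = y")
      case True
      then have "k = 1" using k m by (auto simp: coxeter_matrix_def one_enat_def)
      then show ?thesis using k True H2[of x] by simp
    next
      case False
      then have "(pos (alt k x y), pos (alt k y x)) \<in> ?H"
        unfolding shephard_relations_def artin_relations_def using k by blast
      then have "(pos (alt k x y), pos (alt k y x)) \<in> word_cong S ?H"
        using k set_alt[of k x y] set_alt[of k y x] by (intro word_cong.rel) auto
      then show ?thesis using k braid_iff_power[of S ?H x y k] H2 by blast
    qed
  qed
  show "word_cong S ?H \<subseteq> word_cong S ?C"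
  proof (rule word_cong_leI)
    fix u v assume uv: "(u, v) \<in> ?H" "u \<in> words S" "v \<in> words S"
    then consider x where "x \<in> S" "u = pos [x, x]" "v = []" |
      x y k where "x \<in> S" "y \<in> S" "m x y = enat k" "u = pos (alt k x y)" "v = pos (alt k y x)"
      by (auto simp: shephard_relations_def artin_relations_def two numeral_2_eq_2)
    then show "(u, v) \<in> word_cong S ?C"
    proof cases
      case 1
      then show ?thesis using C2 by simp
    next
      case (2 x y k)
      then have "(pos (concat (replicate k [x, y])), []) \<in> ?C"
        by (auto simp: coxeter_relations_def)
      then have "(pos (concat (replicate k [x, y])), []) \<in> word_cong S ?C"
        using 2 by (intro word_cong.rel) auto
      then show ?thesis using 2 braid_iff_power[of S ?C x y k] C2 by blast
    qed
  qed
qed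

lemma artin_relations_shephard: "artin_relations S m = shephard_relations S (\<lambda>_. \<infinity>) m"
  by (simp add: shephard_relations_def)

lemma map_apfst_words: "w \<in> words S \<Longrightarrow> f ` S \<subseteq> T \<Longrightarrow> map (apfst f) w \<in> words T"
  by (force simp: words_def lists_eq_set)

lemma word_cong_map:
  assumes "(u, v) \<in> word_cong S R" "f ` S \<subseteq> T"
    and "map_prod (map (apfst f)) (map (apfst f)) ` R \<subseteq> Q"
  shows "(map (apfst f) u, map (apfst f) v) \<in> word_cong T Q"
  using assms(1)
proof induction
  case (rel u v)
  then show ?case using assms(2,3) by (intro word_cong.rel) (force intro: map_apfst_words)+
next
  case (cancel x b)
  then show ?case using assms(2) by (auto intro!: word_cong.cancel)
next
  case (ctxt u v p q)
  then show ?case using assms(2) by (auto intro!: word_cong.ctxt intro: map_apfst_words)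
qed (use assms(2) in \<open>auto intro: word_cong.intros map_apfst_words\<close>)

lemma words_map_apfst_iff: "map (apfst f) w \<in> words T \<longleftrightarrow> w \<in> words (f -` T)"
  by (induction w) auto

lemma vimage_Plus: "Inl -` (S <+> S') = S" "Inr -` (S <+> S') = S'"
  by auto

lemma free_product_cong_le:
  assumes "word_cong S R \<subseteq> word_cong S Q" "word_cong S' R' \<subseteq> word_cong S' Q'"
  shows "word_cong (S <+> S') (free_product_relations R R') \<subseteq>
    word_cong (S <+> S') (free_product_relations Q Q')"
proof (rule word_cong_leI)
  fix u v
  assume uv: "(u, v) \<in> free_product_relations R R'" "u \<in> words (S <+> S')" "v \<in> words (S <+> S')"
  then consider
    a b where "(a, b) \<in> R" "u = map (apfst Inl) a" "v = map (apfst Inl) b" |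
    a b where "(a, b) \<in> R'" "u = map (apfst Inr) a" "v = map (apfst Inr) b"
    by (auto simp: free_product_relations_def)
  then show "(u, v) \<in> word_cong (S <+> S') (free_product_relations Q Q')"
  proof cases
    case 1
    have "a \<in> words S" "b \<in> words S"
      using uv 1 by (simp_all add: words_map_apfst_iff vimage_Plus)
    then have "(a, b) \<in> word_cong S Q" using 1 assms by (auto intro: word_cong.rel)
    then show ?thesis using 1
      by (auto intro!: word_cong_map[of _ _ S Q] simp: free_product_relations_def)
  next
    case 2
    have "a \<in> words S'" "b \<in> words S'"
      using uv 2 by (simp_all add: words_map_apfst_iff vimage_Plus)
    then have "(a, b) \<in> word_cong S' Q'" using 2 assms by (auto intro: word_cong.rel)
    then show ?thesis using 2
      by (auto intro!: word_cong_map[of _ _ S' Q'] simp: free_product_relations_def)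
  qed
qed

definition sum_matrix ::
  "('a \<Rightarrow> 'a \<Rightarrow> enat) \<Rightarrow> ('b \<Rightarrow> 'b \<Rightarrow> enat) \<Rightarrow> 'a + 'b \<Rightarrow> 'a + 'b \<Rightarrow> enat" where
  "sum_matrix m m' =
    case_sum (\<lambda>x. case_sum (m x) (\<lambda>_. \<infinity>)) (\<lambda>x'. case_sum (\<lambda>_. \<infinity>) (m' x'))"

lemma map_apfst_pos: "map (apfst f) (pos xs) = pos (map f xs)"
  by (simp add: pos_def)

lemma map_alt: "map f (alt k x y) = alt k (f x) (f y)"
  by (induction k arbitrary: x y) auto

lemma free_product_artin_relations:
  "free_product_relations (artin_relations S m) (artin_relations S' m') =
    artin_relations (S <+> S') (sum_matrix m m')" (is "?L = ?R")
proof
  show "?L \<subseteq> ?R"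
  proof
    fix r assume "r \<in> ?L"
    then consider
      q where "q \<in> artin_relations S m" "r = map_prod (map (apfst Inl)) (map (apfst Inl)) q" |
      q where "q \<in> artin_relations S' m'" "r = map_prod (map (apfst Inr)) (map (apfst Inr)) q"
      unfolding free_product_relations_def by (elim UnE imageE) metis+
    then show "r \<in> ?R"
    proof cases
      case (1 q)
      then obtain x y k where q: "q = (pos (alt k x y), pos (alt k y x))"
        "x \<in> S" "y \<in> S" "x \<noteq> y" "m x y = enat k"
        unfolding artin_relations_def by blast
      show ?thesis unfolding artin_relations_def mem_Collect_eq
        by (rule exI[of _ "Inl x"], rule exI[of _ "Inl y"], rule exI[of _ k])
          (simp add: q 1(2) InlI InrI sum_matrix_def map_apfst_pos map_alt)
    next
      case (2 q)
      then obtain x y k where q: "q = (pos (alt k x y), pos (alt k y x))"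
        "x \<in> S'" "y \<in> S'" "x \<noteq> y" "m' x y = enat k"
        unfolding artin_relations_def by blast
      show ?thesis unfolding artin_relations_def mem_Collect_eq
        by (rule exI[of _ "Inr x"], rule exI[of _ "Inr y"], rule exI[of _ k])
          (simp add: q 2(2) InlI InrI sum_matrix_def map_apfst_pos map_alt)
    qed
  qed
  show "?R \<subseteq> ?L"
  proof
    fix r assume "r \<in> ?R"
    then obtain a b k where r: "r = (pos (alt k a b), pos (alt k b a))"
      "a \<in> S <+> S'" "b \<in> S <+> S'" "a \<noteq> b" "sum_matrix m m' a b = enat k"
      by (auto simp: artin_relations_def)
    then consider
      x y where "a = Inl x" "b = Inl y" "x \<in> S" "y \<in> S" "x \<noteq> y" "m x y = enat k" |
      x y where "a = Inr x" "b = Inr y" "x \<in> S'" "y \<in> S'" "x \<noteq> y" "m' x y = enat k"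
      by (cases a; cases b) (auto simp: sum_matrix_def)
    then show "r \<in> ?L"
    proof cases
      case (1 x y)
      then have "(pos (alt k x y), pos (alt k y x)) \<in> artin_relations S m"
        using r by (auto simp: artin_relations_def)
      then show ?thesis unfolding free_product_relations_def
        by (intro UnI1 image_eqI[of r]) (simp_all add: r(1) 1 map_apfst_pos map_alt)
    next
      case (2 x y)
      then have "(pos (alt k x y), pos (alt k y x)) \<in> artin_relations S' m'"
        using r by (auto simp: artin_relations_def)
      then show ?thesis unfolding free_product_relations_def
        by (intro UnI2 image_eqI[of r]) (simp_all add: r(1) 2 map_apfst_pos map_alt)
    qed
  qed
qed

lemma free_product_order_relations:
  "free_product_relations
      {(pos (replicate k x), []) | x k. x \<in> S \<and> p x = enat k}
      {(pos (replicate k x), []) | x k. x \<in> S' \<and> p' x = enat k} =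
    {(pos (replicate k x), []) | x k. x \<in> S <+> S' \<and> case_sum p p' x = enat k}" (is "?L = ?R")
proof
  show "?L \<subseteq> ?R"
  proof
    fix r assume "r \<in> ?L"
    then consider
      x k where "r = (pos (replicate k (Inl x)), [])" "x \<in> S" "p x = enat k" |
      x k where "r = (pos (replicate k (Inr x)), [])" "x \<in> S'" "p' x = enat k"
      unfolding free_product_relations_def by (auto simp: map_apfst_pos)
    then show "r \<in> ?R" by cases force+
  qed
  show "?R \<subseteq> ?L"
  proof
    fix r assume "r \<in> ?R"
    then consider
      x k where "r = (pos (replicate k (Inl x)), [])" "x \<in> S" "p x = enat k" |
      x k where "r = (pos (replicate k (Inr x)), [])" "x \<in> S'" "p' x = enat k"
      by auto
    then show "r \<in> ?L"
    proof cases
      case (1 x k)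
      then show ?thesis unfolding free_product_relations_def
        by (intro UnI1 image_eqI[of _ _ "(pos (replicate k x), [])"]) (auto simp: map_apfst_pos)
    next
      case (2 x k)
      then show ?thesis unfolding free_product_relations_def
        by (intro UnI2 image_eqI[of _ _ "(pos (replicate k x), [])"]) (auto simp: map_apfst_pos)
    qed
  qed
qed

lemma free_product_Un:
  "free_product_relations (R \<union> Q) (R' \<union> Q') =
    free_product_relations R R' \<union> free_product_relations Q Q'"
  by (auto simp: free_product_relations_def)

lemma free_product_shephard_relations:
  "free_product_relations (shephard_relations S p m) (shephard_relations S' p' m') =
    shephard_relations (S <+> S') (case_sum p p') (sum_matrix m m')"
  by (simp add: shephard_relations_def free_product_Un free_product_artin_relations
      free_product_order_relations)

lemma free_product_is_shephard:
  assumes "coxeter_matrix S m" "coxeter_matrix S' m'"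
    and "R = artin_relations S m \<and> p = (\<lambda>_. \<infinity>) \<or> R = coxeter_relations S m \<and> p = (\<lambda>_. 2)"
    and "R' = artin_relations S' m' \<and> p' = (\<lambda>_. \<infinity>) \<or>
      R' = coxeter_relations S' m' \<and> p' = (\<lambda>_. 2)"
  defines "Q \<equiv> shephard_relations (S <+> S') (case_sum p p') (sum_matrix m m')"
  shows "presented_group (S <+> S') (free_product_relations R R') = presented_group (S <+> S') Q"
    and "gen (S <+> S') (free_product_relations R R') = gen (S <+> S') Q"
proof -
  have "word_cong S R = word_cong S (shephard_relations S p m)"
    using assms(1,3) coxeter_relations_shephard artin_relations_shephard by metis
  moreover have "word_cong S' R' = word_cong S' (shephard_relations S' p' m')"
    using assms(2,4) coxeter_relations_shephard artin_relations_shephard by metis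
  ultimately have "word_cong (S <+> S') (free_product_relations R R') = word_cong (S <+> S') Q"
    unfolding Q_def free_product_shephard_relations[symmetric]
    by (intro equalityI free_product_cong_le) auto
  then show "presented_group (S <+> S') (free_product_relations R R') =
      presented_group (S <+> S') Q"
    and "gen (S <+> S') (free_product_relations R R') = gen (S <+> S') Q"
    by (rule presented_group_cong)+
qed

end

theory Submission
  imports Defs Complex_Main
begin

text \<open>Let W be the Coxeter group of the matrix of G, acting on its geometric representation. A word
  over S is retracted to a word over X by reading it from the left while keeping track of the
  minimal representative w of the current coset of the parabolic subgroup of X in W: a letter s is
  replaced by w s w^{-1} if this is an element of X, and is dropped otherwise, in which case w s is
  the next minimal representative (Charney and Paris). The roots of the dihedral subgroup of s and t
  show that this respects the braid relation of s and t. Hence one gets a map from G to the subgroup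
  of X which commutes with left multiplication by that subgroup and maps the subgroup of Y into the
  subgroup of the intersection of X and Y. Parts (a) and (b) follow formally, and the argument
  for (b) also gives the Helly property of cosets that makes the coset complex a flag complex.\<close>

section \<open>Alternating words and Chebyshev numbers\<close>

text \<open>\<open>sum_matrix\<close> turns the free product into a single Coxeter matrix with label
  \<infinity> between the factors, so both factors are treated at once; only the orders 2 or
  \<infinity> of the generators still tell a Coxeter factor from an Artin-Tits one. The obstacle is
  that the retraction is in general not a homomorphism: it must be defined on words and checked
  against every relation, in every context and so from every state of the reading. The geometric
  representation makes the test decidable by linear algebra: w s w^{-1} = x means that w sends the
  simple root of s to plus or minus that of x, and minimality of w excludes the minus sign. Along a
  braid relation this test runs through the positive roots of a rank 2 subsystem, whose coordinates
  are the Chebyshev numbers. Faithfulness of the representation enters only for the square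
  relations, where s and the kept letter x must have the same order.\<close>

fun cheb :: "real \<Rightarrow> nat \<Rightarrow> real" where
  "cheb c 0 = 0"
| "cheb c (Suc 0) = 1"
| "cheb c (Suc (Suc n)) = 2 * c * cheb c (Suc n) - cheb c n"

text \<open>\<open>cheb c n\<close> is the Chebyshev polynomial of the second kind of degree
  \<open>n - 1\<close> at \<open>c\<close>. The factor \<open>sin \<theta>\<close> stays on the left
  so that \<theta> = 0 is covered without division.\<close>

lemma cheb_cos: "sin \<theta> * cheb (cos \<theta>) n = sin (n * \<theta>)"
proof (induction "cos \<theta>" n rule: cheb.induct)
  case (3 n)
  have "sin (Suc (Suc n) * \<theta>) = sin (Suc n * \<theta> + \<theta>)" "sin (n * \<theta>) = sin (Suc n * \<theta> - \<theta>)"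
    by (simp_all add: algebra_simps)
  then have "sin (Suc (Suc n) * \<theta>) + sin (n * \<theta>) = 2 * cos \<theta> * sin (Suc n * \<theta>)"
    by (simp add: sin_add sin_diff)
  then show ?case using 3 by (simp add: algebra_simps)
qed auto

text \<open>The degenerate angle 0, which belongs to the label \<infinity>.\<close>

lemma cheb_1: "cheb 1 n = n"
  by (induction "1::real" n rule: cheb.induct) auto

lemma sin_pi_div_pos: "2 \<le> k \<Longrightarrow> 0 < sin (pi / real k)"
  by (rule sin_gt_zero) (auto simp: field_simps)

lemma cheb_pi_div: "2 \<le> k \<Longrightarrow> cheb (cos (pi / real k)) n = sin (n * (pi / k)) / sin (pi / k)"
  using cheb_cos[of "pi / k" n] sin_pi_div_pos[of k] by (simp add: field_simps)

lemma cheb_pi_div_pos: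
  assumes "2 \<le> k" "0 < n" "n < k"
  shows "0 < cheb (cos (pi / real k)) n"
proof -
  have "0 < sin (n * (pi / k))"
    by (rule sin_gt_zero) (use assms in \<open>auto simp: field_simps\<close>)
  then show ?thesis using assms by (simp add: cheb_pi_div sin_pi_div_pos)
qed

lemma cheb_pi_div_nonneg:
  assumes "2 \<le> k" "n \<le> k"
  shows "0 \<le> cheb (cos (pi / real k)) n"
proof -
  have "0 \<le> sin (n * (pi / k))"
    by (rule sin_ge_zero) (use assms in \<open>auto simp: field_simps\<close>)
  then show ?thesis using assms by (simp add: cheb_pi_div sin_pi_div_pos less_imp_le)
qed

lemma cheb_pi_div_symmetric:
  assumes "2 \<le> k" "n \<le> k"
  shows "cheb (cos (pi / real k)) (k - n) = cheb (cos (pi / real k)) n"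
proof -
  have "real (k - n) * (pi / k) = pi - n * (pi / k)"
    using assms by (simp add: of_nat_diff field_simps)
  then show ?thesis using assms by (simp add: cheb_pi_div)
qed

lemma cheb_pi_div_end:
  assumes "2 \<le> k"
  shows "cheb (cos (pi / real k)) k = 0" "cheb (cos (pi / real k)) (k - 1) = 1"
    "cheb (cos (pi / real k)) (Suc k) = - 1"
proof -
  show *: "cheb (cos (pi / real k)) k = 0" "cheb (cos (pi / real k)) (k - 1) = 1"
    using cheb_pi_div_symmetric[of k 0] cheb_pi_div_symmetric[of k 1] assms by auto
  obtain j where "k = Suc j" using assms by (cases k) auto
  then show "cheb (cos (pi / real k)) (Suc k) = - 1" using * by auto
qed

text \<open>The recurrence has a step matrix of determinant 1, so this 2 by 2 determinant does not
  depend on \<open>i\<close>; at \<open>i = 0\<close> it is \<open>cheb c j\<close>. It will show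
  that two different roots of a finite dihedral subsystem are linearly independent.\<close>

lemma cheb_det: "cheb c (Suc i) * cheb c (i + j) - cheb c i * cheb c (Suc (i + j)) = cheb c j"
proof (induction i)
  case (Suc i)
  have "cheb c (Suc (Suc i)) * cheb c (Suc i + j) - cheb c (Suc i) * cheb c (Suc (Suc i + j)) =
    cheb c (Suc i) * cheb c (i + j) - cheb c i * cheb c (Suc (i + j))"
    by (simp add: algebra_simps)
  with Suc show ?case by simp
qed simp

lemma length_alt [simp]: "length (alt k x y) = k"
  by (induction k arbitrary: x y) auto

lemma alt_add: "alt (i + j) x y = alt i x y @ (if even i then alt j x y else alt j y x)"
  by (induction i arbitrary: x y) auto

lemma alt_Suc_snoc: "alt (Suc j) x y = alt j x y @ [if even j then x else y]"
  using alt_add[of j 1 x y] by auto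

lemma take_alt: "j \<le> k \<Longrightarrow> take j (alt k x y) = alt j x y"
  using alt_add[of j "k - j" x y] by (auto simp: take_append)

lemma nth_alt: "j < k \<Longrightarrow> alt k x y ! j = (if even j then x else y)"
  by (induction k arbitrary: x y j) (auto simp: nth_Cons split: nat.splits)


section \<open>The geometric representation\<close>

definition unit_vec :: "'s \<Rightarrow> 's \<Rightarrow> real" where
  "unit_vec s = (\<lambda>x. if x = s then 1 else 0)"

lemma unit_vec_simps [simp]: "unit_vec s s = 1" "x \<noteq> s \<Longrightarrow> unit_vec s x = 0"
  by (auto simp: unit_vec_def)

lemma unit_vec_nonneg: "0 \<le> unit_vec s x"
  by (simp add: unit_vec_def)

lemma unit_vec_inject [simp]: "unit_vec s = unit_vec t \<longleftrightarrow> s = t"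
  by (metis unit_vec_simps zero_neq_one)

locale coxeter_system =
  fixes S :: "'s set" and m :: "'s \<Rightarrow> 's \<Rightarrow> enat"
  assumes finite_S: "finite S" and matrix: "coxeter_matrix S m"
begin

text \<open>The negative of this matrix is the Gram matrix of the Tits form. The diagonal needs no
  separate case, since the label 1 gives \<open>cos pi = - 1\<close>.\<close>

definition mcos :: "'s \<Rightarrow> 's \<Rightarrow> real" where
  "mcos x y = (case m x y of enat k \<Rightarrow> cos (pi / real k) | \<infinity> \<Rightarrow> 1)"

definition form :: "('s \<Rightarrow> real) \<Rightarrow> ('s \<Rightarrow> real) \<Rightarrow> real" where
  "form u v = (\<Sum>x\<in>S. \<Sum>y\<in>S. - mcos x y * u x * v y)"

definition reflect :: "'s \<Rightarrow> ('s \<Rightarrow> real) \<Rightarrow> 's \<Rightarrow> real" where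
  "reflect s v = (\<lambda>x. v x - 2 * form (unit_vec s) v * unit_vec s x)"

definition act :: "'s list \<Rightarrow> ('s \<Rightarrow> real) \<Rightarrow> 's \<Rightarrow> real" where
  "act w = foldr reflect w"

lemma m_sym: "x \<in> S \<Longrightarrow> y \<in> S \<Longrightarrow> m x y = m y x"
  and m_ge_2: "x \<in> S \<Longrightarrow> y \<in> S \<Longrightarrow> x \<noteq> y \<Longrightarrow> 2 \<le> m x y"
  and m_diag: "x \<in> S \<Longrightarrow> m x x = 1"
  using matrix by (auto simp: coxeter_matrix_def)

lemma m_enat_ge_2: "x \<in> S \<Longrightarrow> y \<in> S \<Longrightarrow> x \<noteq> y \<Longrightarrow> m x y = enat k \<Longrightarrow> 2 \<le> k"
  using m_ge_2[of x y] by (simp add: numeral_eq_enat)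

lemma mcos_sym: "x \<in> S \<Longrightarrow> y \<in> S \<Longrightarrow> mcos x y = mcos y x"
  by (simp add: mcos_def m_sym)

lemma mcos_diag: "x \<in> S \<Longrightarrow> mcos x x = - 1"
  by (simp add: mcos_def m_diag one_enat_def)

lemma form_sym: "form u v = form v u"
proof -
  have "form u v = (\<Sum>x\<in>S. \<Sum>y\<in>S. - mcos y x * u x * v y)"
    unfolding form_def by (intro sum.cong refl) (auto simp: mcos_sym)
  also have "\<dots> = (\<Sum>y\<in>S. \<Sum>x\<in>S. - mcos y x * u x * v y)" by (rule sum.swap)
  finally show ?thesis by (simp add: form_def algebra_simps)
qed

lemma form_add_right: "form u (\<lambda>x. v x + w x) = form u v + form u w"
  unfolding form_def sum.distrib[symmetric] by (simp add: distrib_left)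

lemma form_scale_right: "form u (\<lambda>x. a * v x) = a * form u v"
  by (simp add: form_def sum_distrib_left algebra_simps)

lemma form_diff_scale_right: "form u (\<lambda>x. v x - a * w x) = form u v - a * form u w"
  using form_add_right[of u v "\<lambda>x. (- a) * w x"] by (simp only: form_scale_right) simp

lemma form_diff_scale_left: "form (\<lambda>x. v x - a * w x) u = form v u - a * form w u"
  using form_diff_scale_right form_sym by metis

lemma form_unit:
  assumes "s \<in> S" "t \<in> S"
  shows "form (unit_vec s) (unit_vec t) = - mcos s t"
proof -
  have "form (unit_vec s) (unit_vec t) =
    (\<Sum>x\<in>S. if x = s then \<Sum>y\<in>S. if y = t then - mcos x y else 0 else 0)"
    unfolding form_def unit_vec_def by (intro sum.cong) (auto intro!: sum.cong)
  then show ?thesis using assms finite_S by simp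
qed

lemma form_unit_self: "s \<in> S \<Longrightarrow> form (unit_vec s) (unit_vec s) = 1"
  by (simp add: form_unit mcos_diag)

lemma reflect_add: "reflect s (\<lambda>x. u x + v x) = (\<lambda>x. reflect s u x + reflect s v x)"
  by (simp add: reflect_def form_add_right algebra_simps)

lemma reflect_scale: "reflect s (\<lambda>x. a * v x) = (\<lambda>x. a * reflect s v x)"
  by (simp add: reflect_def form_scale_right algebra_simps)

lemma reflect_other: "x \<noteq> s \<Longrightarrow> reflect s v x = v x"
  by (simp add: reflect_def)

lemma form_refl: "s \<in> S \<Longrightarrow> form (reflect s u) (reflect s v) = form u v"
  by (simp add: reflect_def form_diff_scale_left form_diff_scale_right form_unit_self
      form_sym[of u "unit_vec s"])

lemma reflect_reflect [simp]: "s \<in> S \<Longrightarrow> reflect s (reflect s v) = v"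
  unfolding reflect_def form_diff_scale_right by (auto simp: form_unit_self)

lemma reflect_unit:
  "s \<in> S \<Longrightarrow> t \<in> S \<Longrightarrow> reflect s (unit_vec t) = (\<lambda>x. unit_vec t x + 2 * mcos s t * unit_vec s x)"
  by (simp add: reflect_def form_unit)

lemma reflect_self: "s \<in> S \<Longrightarrow> reflect s (unit_vec s) = (\<lambda>x. - 1 * unit_vec s x)"
  by (simp add: reflect_unit mcos_diag fun_eq_iff)

section \<open>Words acting as products of reflections\<close>

lemma act_Nil [simp]: "act [] = id" and act_Cons: "act (s # w) v = reflect s (act w v)"
  by (auto simp: act_def)

lemma act_append: "act (u @ v) = act u \<circ> act v"
  by (induction u) (simp_all add: act_def fun_eq_iff)

lemma act_single [simp]: "act [s] = reflect s"
  by (simp add: act_def)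

lemma act_add: "act w (\<lambda>x. u x + v x) = (\<lambda>x. act w u x + act w v x)"
  by (induction w) (auto simp: act_Cons reflect_add)

lemma act_scale: "act w (\<lambda>x. a * v x) = (\<lambda>x. a * act w v x)"
  by (induction w) (auto simp: act_Cons reflect_scale)

lemma act_lin: "act w (\<lambda>x. a * u x + b * v x) = (\<lambda>x. a * act w u x + b * act w v x)"
  by (simp add: act_add act_scale)

lemma act_zero: "act w (\<lambda>x. 0) = (\<lambda>x. 0)"
  using act_scale[of w 0 "\<lambda>x. 0"] by simp

lemma act_sum: "finite X \<Longrightarrow> act w (\<lambda>y. \<Sum>x\<in>X. g x y) = (\<lambda>y. \<Sum>x\<in>X. act w (g x) y)"
  by (induction X rule: finite_induct) (auto simp: act_add act_zero)

lemma form_act: "set w \<subseteq> S \<Longrightarrow> form (act w u) (act w v) = form u v"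
  by (induction w) (auto simp: act_Cons form_refl)

lemma act_other: "x \<notin> set w \<Longrightarrow> act w v x = v x"
  by (induction w) (auto simp: act_Cons reflect_other)

lemma act_rev_act [simp]: "set w \<subseteq> S \<Longrightarrow> act (rev w) (act w v) = v"
  by (induction w arbitrary: v) (auto simp: act_Cons act_append)

lemma act_act_rev [simp]: "set w \<subseteq> S \<Longrightarrow> act w (act (rev w) v) = v"
  using act_rev_act[of "rev w" v] by simp

lemma act_snoc_self: "s \<in> S \<Longrightarrow> act (w @ [s]) (unit_vec s) = (\<lambda>x. - act w (unit_vec s) x)"
  by (simp only: act_append act_single comp_apply reflect_self act_scale) simp

text \<open>Conjugating a reflection by an isometry moves its root along: this is w s = x w as soon
  as w maps the root of s to that of x.\<close>

lemma act_conj_refl: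
  assumes "set w \<subseteq> S" "s \<in> S" "act w (unit_vec s) = unit_vec x"
  shows "act w \<circ> reflect s = reflect x \<circ> act w"
proof
  fix v
  have "reflect s v = (\<lambda>z. 1 * v z + (- 2 * form (unit_vec s) v) * unit_vec s z)"
    by (simp add: reflect_def)
  then have "act w (reflect s v) =
      (\<lambda>z. act w v z - 2 * form (unit_vec s) v * unit_vec x z)"
    by (simp only: act_lin assms) simp
  also have "form (unit_vec s) v = form (unit_vec x) (act w v)"
    using form_act[OF assms(1), of "unit_vec s" v] assms by simp
  finally show "(act w \<circ> reflect s) v = (reflect x \<circ> act w) v" by (simp add: reflect_def)
qed

text \<open>These are the roots met along an alternating word: a prefix of length \<open>k\<close>
  applied to the simple root of the letter that follows it. Removing the first letter exchanges the
  roles of \<open>s\<close> and \<open>t\<close>.\<close>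

lemma act_alt_unit:
  assumes "s \<in> S" "t \<in> S"
  shows "act (alt k s t) (unit_vec (if even k then s else t)) =
    (\<lambda>x. cheb (mcos s t) (Suc k) * unit_vec s x + cheb (mcos s t) k * unit_vec t x)"
  using assms
proof (induction k arbitrary: s t)
  case (Suc k)
  have "act (alt (Suc k) s t) (unit_vec (if even (Suc k) then s else t)) =
      reflect s (act (alt k t s) (unit_vec (if even k then t else s)))"
    by (auto simp: act_Cons)
  also have "\<dots> = reflect s (\<lambda>x. cheb (mcos s t) (Suc k) * unit_vec t x + cheb (mcos s t) k * unit_vec s x)"
    using Suc by (simp add: mcos_sym)
  also have "\<dots> = (\<lambda>x. cheb (mcos s t) (Suc k) * reflect s (unit_vec t) x + cheb (mcos s t) k * reflect s (unit_vec s) x)"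
    by (simp add: reflect_add reflect_scale)
  also have "\<dots> = (\<lambda>x. cheb (mcos s t) (Suc (Suc k)) * unit_vec s x + cheb (mcos s t) (Suc k) * unit_vec t x)"
    using Suc.prems by (auto simp: reflect_unit reflect_self algebra_simps mcos_sym mcos_diag)
  finally show ?case .
qed auto

text \<open>The alternating word of length \<open>k\<close> is the longest element of the dihedral
  group; it negates the two simple roots and exchanges them iff \<open>k\<close> is odd. The proof
  treats the letter that would come next and the last letter separately.\<close>

lemma act_alt_braid_unit:
  assumes "s \<in> S" "t \<in> S" "s \<noteq> t" "m s t = enat k"
  shows "act (alt k s t) (unit_vec s) = (\<lambda>x. - unit_vec (if even k then s else t) x)"
    "act (alt k s t) (unit_vec t) = (\<lambda>x. - unit_vec (if even k then t else s) x)"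
proof -
  have k: "2 \<le> k" and c: "mcos s t = cos (pi / k)"
    using m_enat_ge_2 assms by (auto simp: mcos_def)
  have next_letter: "act (alt k s t) (unit_vec (if even k then s else t)) = (\<lambda>x. - unit_vec s x)"
    using act_alt_unit[OF assms(1,2), of k] cheb_pi_div_end[OF k] by (simp add: c)
  obtain j where j: "k = Suc j" using k by (cases k) auto
  have *: "act (alt j s t) (unit_vec (if even j then s else t)) = unit_vec t"
    using act_alt_unit[OF assms(1,2), of j] cheb_pi_div_end[OF k] by (simp add: c j)
  have last_letter: "act (alt k s t) (unit_vec (if even j then s else t)) = (\<lambda>x. - unit_vec t x)"
    unfolding j alt_Suc_snoc using * assms by (subst act_snoc_self) auto
  show "act (alt k s t) (unit_vec s) = (\<lambda>x. - unit_vec (if even k then s else t) x)"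
    "act (alt k s t) (unit_vec t) = (\<lambda>x. - unit_vec (if even k then t else s) x)"
    using next_letter last_letter j by (auto split: if_splits)
qed

lemma act_orthogonal:
  assumes "\<And>s. s \<in> set w \<Longrightarrow> form (unit_vec s) v = 0"
  shows "act w v = v"
  using assms by (induction w) (auto simp: act_Cons reflect_def)

lemma act_braid:
  assumes "s \<in> S" "t \<in> S" "s \<noteq> t" "m s t = enat k"
  shows "act (alt k s t) = act (alt k t s)"
proof
  fix v
  have k: "2 \<le> k" and c: "mcos s t = cos (pi / k)"
    using m_enat_ge_2 assms by (auto simp: mcos_def)
  define d a b where "d = 1 - (mcos s t)\<^sup>2" and "a = form (unit_vec s) v" and "b = form (unit_vec t) v"
  have "d = (sin (pi / k))\<^sup>2" by (simp add: d_def c sin_squared_eq)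
  then have d: "d \<noteq> 0" using sin_pi_div_pos[OF k] by simp
  text \<open>The component of v in the span of the two simple roots; it exists because the form is
    nondegenerate there.\<close>
  define A B where "A = (a + mcos s t * b) / d" and "B = (b + mcos s t * a) / d"
  define p where "p = (\<lambda>x. A * unit_vec s x + B * unit_vec t x)"
  define q where "q = (\<lambda>x. v x - 1 * p x)"
  have form_p: "form (unit_vec r) p =
      A * form (unit_vec r) (unit_vec s) + B * form (unit_vec r) (unit_vec t)" for r
    unfolding p_def form_add_right form_scale_right ..
  \<comment> \<open>Cramer's rule for the Gram matrix of the two roots: 1 on the diagonal,
    \<open>- mcos s t\<close> off it, determinant \<open>d\<close>.\<close>
  have solve: "(a' + mcos s t * b') / d - mcos s t * ((b' + mcos s t * a') / d) = a'" for a' b'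
    using d by (simp add: divide_simps) (simp add: d_def algebra_simps power2_eq_square)
  have "form (unit_vec s) p = a" "form (unit_vec t) p = b"
    unfolding form_p using assms solve[of a b, folded A_def B_def] solve[of b a, folded A_def B_def]
    by (simp_all add: form_unit mcos_diag mcos_sym[of t s] mult.commute)
  then have "form (unit_vec s) q = 0" "form (unit_vec t) q = 0"
    unfolding q_def form_diff_scale_right by (simp_all add: a_def b_def)
  then have q: "act (alt k s t) q = q" "act (alt k t s) q = q"
    using set_alt[of k s t] set_alt[of k t s] by (auto intro!: act_orthogonal)
  have "act (alt k s t) p = act (alt k t s) p"
    unfolding p_def act_lin using act_alt_braid_unit[OF assms]
      act_alt_braid_unit[of t s k] assms by (simp add: m_sym[of t s])
  moreover have "v = (\<lambda>x. p x + q x)" by (simp add: q_def)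
  ultimately show "act (alt k s t) v = act (alt k t s) v"
    using q by (simp add: act_add)
qed


section \<open>Positivity of roots\<close>

text \<open>Equality in the Coxeter group, on words without signs because generators are
  involutions. Words are not confined to \<open>S\<close> by the rules; \<open>ceq_set\<close>
  transports that condition where it matters.\<close>

inductive ceq :: "'s list \<Rightarrow> 's list \<Rightarrow> bool" where
  ceq_refl: "ceq w w"
| ceq_sym: "ceq u v \<Longrightarrow> ceq v u"
| ceq_trans: "ceq u v \<Longrightarrow> ceq v w \<Longrightarrow> ceq u w"
| ceq_ctxt: "ceq u v \<Longrightarrow> ceq (p @ u @ q) (p @ v @ q)"
| ceq_square: "s \<in> S \<Longrightarrow> ceq [s, s] []"
| ceq_braid: "\<lbrakk>s \<in> S; t \<in> S; s \<noteq> t; m s t = enat k\<rbrakk> \<Longrightarrow> ceq (alt k s t) (alt k t s)"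

lemma ceq_append: "ceq u u' \<Longrightarrow> ceq v v' \<Longrightarrow> ceq (u @ v) (u' @ v')"
  using ceq_ctxt[of u u' "[]" v] ceq_ctxt[of v v' u' "[]"] by (auto intro: ceq_trans)

lemma ceq_append_square: "s \<in> S \<Longrightarrow> ceq (u @ [s, s] @ v) (u @ v)"
  using ceq_ctxt[OF ceq_square, of s u v] by simp

lemma set_alt_eq: "set (alt k x y) = (if k = 0 then {} else if k = 1 then {x} else {x, y})"
proof (induction k arbitrary: x y)
  case (Suc k)
  then show ?case by auto
qed simp

lemma ceq_set: "ceq u v \<Longrightarrow> set u \<subseteq> S \<longleftrightarrow> set v \<subseteq> S"
  by (induction rule: ceq.induct) (auto simp: set_alt_eq split: if_splits)

lemma ceq_act: "ceq u v \<Longrightarrow> act u = act v"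
proof (induction rule: ceq.induct)
  case (ceq_square s)
  then show ?case by (simp add: act_Cons fun_eq_iff)
qed (auto simp: act_append intro: act_braid)

section \<open>Length and the sign of roots\<close>

definition len :: "'s list \<Rightarrow> nat" where
  "len w = (LEAST n. \<exists>u. ceq w u \<and> length u = n)"

lemma len_le: "ceq w u \<Longrightarrow> len w \<le> length u"
  unfolding len_def by (rule Least_le) auto

lemma reduced_word: "\<exists>u. ceq w u \<and> length u = len w"
  unfolding len_def by (rule LeastI[of _ "length w"]) (auto intro: ceq_refl)

lemma len_ceq: "ceq u v \<Longrightarrow> len u = len v"
  by (metis ceq_sym ceq_trans le_antisym len_le reduced_word)

lemma len_append: "len (u @ v) \<le> len u + length v"
  by (metis ceq_append ceq_refl length_append len_le reduced_word)

lemma act_nonneg_if_len_le: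
  assumes "set w \<subseteq> S" "s \<in> S" "len w \<le> len (w @ [s])"
  shows "0 \<le> act w (unit_vec s) x"
  using assms
proof (induction "len w" arbitrary: w s x rule: less_induct)
  case less
  note w = \<open>set w \<subseteq> S\<close> and s = \<open>s \<in> S\<close>
  obtain r where r: "ceq w r" "length r = len w" using reduced_word by blast
  show ?case
  proof (cases r rule: rev_cases)
    case Nil
    then show ?thesis using ceq_act[OF r(1)] by (simp add: unit_vec_nonneg)
  next
    case (snoc r' t)
    have r': "set r' \<subseteq> S" and t: "t \<in> S" using ceq_set[OF r(1)] w snoc by auto
    have "t \<noteq> s"
    proof
      assume "t = s"
      then have "ceq (w @ [s]) r'"
        using ceq_append[OF r(1) ceq_refl, of "[s]"] ceq_append_square[OF s, of r' "[]"] snoc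
        by (auto intro: ceq_trans)
      then have "len (w @ [s]) \<le> length r'" by (rule len_le)
      with less.prems(3) r snoc show False by simp
    qed
    text \<open>Humphreys' argument: split off from w an alternating suffix in s and t, ending with t, that
      is as long as possible. The remaining prefix v is shorter than w and sends the roots of s and t
      to positive roots, by induction.\<close>
    define x0 y0 where "x0 k = (if even k then s else t)" and "y0 k = (if even k then t else s)"
      for k :: nat
    have x0: "x0 k \<in> S" "y0 k \<in> S" "x0 k \<noteq> y0 k" for k
      using s t \<open>t \<noteq> s\<close> by (auto simp: x0_def y0_def)
    have alt_Suc: "alt (Suc k) (x0 (Suc k)) (y0 (Suc k)) = y0 k # alt k (x0 k) (y0 k)" for k
      by (simp add: x0_def y0_def)
    define P where "P k \<longleftrightarrow> (\<exists>v. ceq w (v @ alt k (x0 k) (y0 k)) \<and> len v + k = len w)" for k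
    have len1: "Suc (len r') = len w"
      using len_le[OF ceq_refl, of r'] len_append[of r' "[t]"] len_ceq[OF r(1)] r(2) snoc by simp
    have "P 1" unfolding P_def using r snoc len1 by (auto simp: x0_def y0_def)
    moreover have bound: "k \<le> len w" if "P k" for k using that by (auto simp: P_def)
    ultimately have Pmax: "P (Greatest P)" and max: "\<And>j. P j \<Longrightarrow> j \<le> Greatest P"
      by (blast intro: GreatestI_nat Greatest_le_nat)+
    define k where "k = Greatest P"
    have "k \<ge> 1" using max[OF \<open>P 1\<close>] by (simp add: k_def)
    then obtain k' where k': "k = Suc k'" by (cases k) auto
    obtain v where v: "ceq w (v @ alt k (x0 k) (y0 k))" "len v + k = len w"
      using Pmax by (auto simp: P_def k_def)
    have vS: "set v \<subseteq> S" using ceq_set[OF v(1)] w by simp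
    \<comment> \<open>Otherwise moving the first letter of the suffix into \<open>v\<close> would
      give an expression for \<open>w\<close> that is too short.\<close>
    have x_up: "len v \<le> len (v @ [x0 k])"
    proof (rule ccontr)
      assume "\<not> ?thesis"
      moreover have "ceq w ((v @ [x0 k]) @ alt k' (y0 k) (x0 k))"
        using v(1) by (simp add: k')
      ultimately show False
        using len_ceq len_append[of "v @ [x0 k]" "alt k' (y0 k) (x0 k)"] v(2) k' by fastforce
    qed
    \<comment> \<open>Otherwise \<open>v\<close> could give up a last letter \<open>y0 k\<close>,
      making the suffix longer than the maximal one.\<close>
    have y_up: "len v \<le> len (v @ [y0 k])"
    proof (rule ccontr)
      assume less: "\<not> ?thesis"
      have "ceq (v @ alt k (x0 k) (y0 k)) ((v @ [y0 k]) @ y0 k # alt k (x0 k) (y0 k))"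
        using ceq_append_square[OF x0(2), of v k "alt k (x0 k) (y0 k)"] by (simp add: ceq_sym)
      with v(1) have *: "ceq w ((v @ [y0 k]) @ alt (Suc k) (x0 (Suc k)) (y0 (Suc k)))"
        unfolding alt_Suc by (blast intro: ceq_trans)
      have "len w \<le> len (v @ [y0 k]) + Suc k"
        using len_ceq[OF *] len_append[of "v @ [y0 k]" "alt (Suc k) (x0 (Suc k)) (y0 (Suc k))"]
        by simp
      with less v(2) have "len (v @ [y0 k]) + Suc k = len w" by simp
      then have "P (Suc k)" unfolding P_def using * by blast
      then show False using max[of "Suc k"] by (simp add: k_def)
    qed
    \<comment> \<open>A suffix of length at least \<open>n\<close> could be rewritten by the braid
      relation to end with \<open>s\<close>, and then \<open>w @ [s]\<close> would be shorter than
      \<open>w\<close>. Strictness puts \<open>Suc k\<close> within the range up to \<open>n\<close>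
      where the Chebyshev numbers are nonnegative.\<close>
    have short: "k < n" if n: "m s t = enat n" for n
    proof (rule ccontr)
      assume "\<not> k < n"
      then obtain j where j: "k = j + n" using le_Suc_ex[of n k] by (auto simp: add.commute)
      define x1 y1 where "x1 = (if even j then x0 k else y0 k)" and "y1 = (if even j then y0 k else x0 k)"
      have 1: "alt k (x0 k) (y0 k) = alt j (x0 k) (y0 k) @ alt n x1 y1"
        by (simp add: j alt_add x1_def y1_def)
      have "2 \<le> n" using m_enat_ge_2[OF s t _ n] \<open>t \<noteq> s\<close> by auto
      then obtain n' where n': "n = Suc n'" by (cases n) auto
      have last: "alt n y1 x1 = alt n' y1 x1 @ [s]"
        unfolding n' alt_Suc_snoc by (auto simp: n' x1_def y1_def x0_def y0_def j)
      have "ceq (alt n x1 y1) (alt n y1 x1)"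
        using s t \<open>t \<noteq> s\<close> n m_sym[OF s t]
        by (intro ceq_braid) (auto simp: x1_def y1_def x0_def y0_def)
      then have "ceq (v @ alt k (x0 k) (y0 k)) ((v @ alt j (x0 k) (y0 k) @ alt n' y1 x1) @ [s])"
        using ceq_ctxt[of "alt n x1 y1" "alt n y1 x1" "v @ alt j (x0 k) (y0 k)" "[]"]
        by (simp add: 1 last)
      with v(1) have "ceq w ((v @ alt j (x0 k) (y0 k) @ alt n' y1 x1) @ [s])"
        by (rule ceq_trans)
      then have "ceq (w @ [s]) ((v @ alt j (x0 k) (y0 k) @ alt n' y1 x1) @ [s] @ [s])"
        using ceq_append[OF _ ceq_refl, of _ _ "[s]"] by fastforce
      then have "ceq (w @ [s]) (v @ alt j (x0 k) (y0 k) @ alt n' y1 x1)"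
        using ceq_append_square[OF s, of "v @ alt j (x0 k) (y0 k) @ alt n' y1 x1" "[]"]
        by (auto intro: ceq_trans)
      from len_ceq[OF this] have "len (w @ [s]) \<le> len v + (j + n')"
        using len_append[of v "alt j (x0 k) (y0 k) @ alt n' y1 x1"] by simp
      with less.prems(3) v(2) j n' show False by simp
    qed
    have pos: "0 \<le> cheb (mcos (x0 k) (y0 k)) j" if "j \<le> Suc k" for j
    proof -
      have c: "mcos (x0 k) (y0 k) = mcos s t" using s t by (auto simp: x0_def y0_def mcos_sym)
      show ?thesis
      proof (cases "m s t")
        case (enat n)
        then show ?thesis
          unfolding c using short[OF enat] that m_enat_ge_2[OF s t _ enat] \<open>t \<noteq> s\<close>
          by (simp add: mcos_def cheb_pi_div_nonneg)
      next
        case infinity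
        then have "mcos s t = 1" by (simp add: mcos_def)
        then show ?thesis unfolding c by (simp add: cheb_1)
      qed
    qed
    have "(if even k then x0 k else y0 k) = s" by (simp add: x0_def y0_def)
    with act_alt_unit[OF x0(1,2), of k k k] have "act w (unit_vec s) =
        act v (\<lambda>x. cheb (mcos (x0 k) (y0 k)) (Suc k) * unit_vec (x0 k) x +
          cheb (mcos (x0 k) (y0 k)) k * unit_vec (y0 k) x)"
      using ceq_act[OF v(1)] by (simp add: act_append)
    moreover have "0 \<le> act v (unit_vec (x0 k)) x" "0 \<le> act v (unit_vec (y0 k)) x"
      using less.hyps[of v] v(2) k' vS x0 x_up y_up by auto
    ultimately show ?thesis using pos by (simp add: act_lin)
  qed
qed

lemma act_nonpos_if_len_less:
  assumes "set w \<subseteq> S" "s \<in> S" "len (w @ [s]) < len w"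
  shows "act w (unit_vec s) x \<le> 0"
proof -
  have "ceq (w @ [s] @ [s]) w" using ceq_append_square[OF assms(2), of w "[]"] by simp
  then have "len ((w @ [s]) @ [s]) = len w" using len_ceq by simp
  then have "0 \<le> act (w @ [s]) (unit_vec s) x"
    using assms by (intro act_nonneg_if_len_le) auto
  then show ?thesis using assms by (simp add: act_snoc_self)
qed

lemma root_sign_cases:
  assumes "set w \<subseteq> S" "s \<in> S"
  obtains "\<And>x. 0 \<le> act w (unit_vec s) x" | "\<And>x. act w (unit_vec s) x \<le> 0"
  using act_nonneg_if_len_le[OF assms] act_nonpos_if_len_less[OF assms] linorder_not_le by blast

text \<open>If a reduced word ends with \<open>s\<close>, the rest sends the root of
  \<open>s\<close> to a nonnegative vector, so the whole word sends it to a nonpositive one; the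
  identity does not.\<close>

lemma act_faithful:
  assumes "set w \<subseteq> S" "act w = id"
  shows "ceq w []"
proof -
  obtain r where r: "ceq w r" "length r = len w" using reduced_word by blast
  show ?thesis
  proof (cases r rule: rev_cases)
    case Nil
    then show ?thesis using r by simp
  next
    case (snoc r' s)
    have S: "set r' \<subseteq> S" "s \<in> S" using ceq_set[OF r(1)] assms snoc by auto
    have "len r' \<le> len (r' @ [s])"
      using len_le[OF ceq_refl, of r'] len_ceq[OF r(1)] r(2) snoc by simp
    then have "0 \<le> act r' (unit_vec s) s" using S by (intro act_nonneg_if_len_le)
    then have "act r (unit_vec s) s \<le> 0" using S snoc by (simp add: act_snoc_self)
    then show ?thesis using ceq_act[OF r(1)] assms by simp
  qed
qed

section \<open>Parity invariants and conjugate generators\<close>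

lemma count_alt_swap:
  assumes "even k \<or> (s \<in> C \<longleftrightarrow> t \<in> C)"
  shows "length (filter (\<lambda>x. x \<in> C) (alt k s t)) = length (filter (\<lambda>x. x \<in> C) (alt k t s))"
  using assms by (induction k rule: nat_induct2) auto

text \<open>A union \<open>C\<close> of classes under odd labels defines a homomorphism from the
  Coxeter group to the group of order 2, sending exactly the generators in \<open>C\<close> to the
  nontrivial element.\<close>

lemma ceq_parity:
  assumes "ceq u v" and odd: "\<And>s t k. \<lbrakk>s \<in> S; t \<in> S; m s t = enat k; odd k\<rbrakk> \<Longrightarrow> s \<in> C \<longleftrightarrow> t \<in> C"
  shows "even (length (filter (\<lambda>x. x \<in> C) u)) \<longleftrightarrow> even (length (filter (\<lambda>x. x \<in> C) v))"
  using assms(1)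
proof induction
  case (ceq_braid s t k)
  then have "even k \<or> (s \<in> C \<longleftrightarrow> t \<in> C)" using odd by blast
  from count_alt_swap[OF this] show ?case by simp
qed auto

text \<open>The word w s w^{-1} x is trivial in the Coxeter group. Count its letters
  \<open>z\<close> with \<open>p z = p s\<close> modulo 2: w and its reverse cancel and s
  contributes one, so x must contribute one too.\<close>

lemma root_image_const:
  fixes p :: "'s \<Rightarrow> 'c"
  assumes odd: "\<And>s t k. \<lbrakk>s \<in> S; t \<in> S; m s t = enat k; odd k\<rbrakk> \<Longrightarrow> p s = p t"
    and w: "set w \<subseteq> S" "s \<in> S" "x \<in> S" "act w (unit_vec s) = unit_vec x"
  shows "p s = p x"
proof -
  have "act (w @ [s] @ rev w @ [x]) = (act w \<circ> reflect s) \<circ> (act (rev w) \<circ> reflect x)"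
    unfolding act_append act_single by (simp only: comp_assoc)
  also have "\<dots> = id" unfolding act_conj_refl[OF w(1,2,4)] using w by (simp add: fun_eq_iff)
  finally have "ceq (w @ [s] @ rev w @ [x]) []" using w by (intro act_faithful) auto
  from ceq_parity[OF this, of "{z. p z = p s}"] have
    "even (length (filter (\<lambda>z. p z = p s) (w @ [s] @ rev w @ [x])))"
    using odd by auto
  then show ?thesis by (auto simp: rev_filter[symmetric] split: if_splits)
qed

text \<open>Reflections preserve the form, so a root has norm 1 and a multiple of a simple root has
  coefficient 1 or -1.\<close>

lemma nonneg_multiple_unit:
  assumes "set w \<subseteq> S" "r \<in> S" "s \<in> S" "\<And>y. 0 \<le> act w (unit_vec r) y"
    and "\<And>y. y \<noteq> s \<Longrightarrow> act w (unit_vec r) y = 0"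
  shows "act w (unit_vec r) = unit_vec s"
proof -
  define a where "a = act w (unit_vec r) s"
  have eq: "act w (unit_vec r) = (\<lambda>y. a * unit_vec s y)"
    using assms(5) by (auto simp: a_def fun_eq_iff unit_vec_def)
  have "form (act w (unit_vec r)) (act w (unit_vec r)) = 1"
    using assms by (simp add: form_act form_unit_self)
  then have "a * a = 1"
    unfolding eq form_scale_right form_sym[of "\<lambda>y. a * unit_vec s y"]
    using assms by (simp add: form_unit_self)
  moreover have "0 \<le> a" using assms(4) by (simp add: a_def)
  ultimately have "a = 1" by (simp add: square_eq_1_iff)
  then show ?thesis using eq by simp
qed


section \<open>Retractions onto parabolic subgroups\<close>

text \<open>An element w of the Coxeter group is represented by its linear map. Positivity of the
  preimages of the simple roots of X says that w is the shortest element of its right coset of the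
  parabolic subgroup of X.\<close>

definition minimal :: "'s set \<Rightarrow> (('s \<Rightarrow> real) \<Rightarrow> 's \<Rightarrow> real) \<Rightarrow> bool" where
  "minimal X f \<longleftrightarrow> (\<exists>w. set w \<subseteq> S \<and> f = act w \<and> (\<forall>x\<in>X. \<forall>y. 0 \<le> act (rev w) (unit_vec x) y))"

lemma minimal_id: "minimal X id"
  unfolding minimal_def by (rule exI[of _ "[]"]) (simp add: unit_vec_nonneg)

definition supp_in :: "'s set \<Rightarrow> ('s \<Rightarrow> real) \<Rightarrow> bool" where
  "supp_in X v \<longleftrightarrow> (\<forall>y. y \<notin> X \<longrightarrow> v y = 0)"

text \<open>Membership in the span of \<open>X\<close> is a linear condition, much easier to follow
  than being a simple root. Applying w^{-1} to the expansion of the root over \<open>X\<close>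
  writes the simple root of \<open>s\<close> as a combination of nonnegative vectors, with
  coefficients of one sign. They must be nonnegative, and then nothing can cancel: a summand that is
  nonzero at \<open>s\<close> is a multiple of the simple root of \<open>s\<close>.\<close>

lemma minimal_root_supp:
  assumes f: "minimal X f" and X: "X \<subseteq> S" and s: "s \<in> S" and supp: "supp_in X (f (unit_vec s))"
  shows "\<exists>x\<in>X. f (unit_vec s) = unit_vec x"
proof -
  obtain w where w: "set w \<subseteq> S" "f = act w" "\<And>x y. x \<in> X \<Longrightarrow> 0 \<le> act (rev w) (unit_vec x) y"
    using f by (auto simp: minimal_def)
  have fin: "finite X" using X finite_S by (rule finite_subset)
  define v where "v = f (unit_vec s)"
  have "v = (\<lambda>y. \<Sum>x\<in>X. v x * unit_vec x y)"
  proof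
    fix y
    have "(\<Sum>x\<in>X. v x * unit_vec x y) = (\<Sum>x\<in>X. if x = y then v x else 0)"
      by (rule sum.cong) (auto simp: unit_vec_def)
    then show "v y = (\<Sum>x\<in>X. v x * unit_vec x y)"
      using supp fin by (auto simp: supp_in_def v_def)
  qed
  then have "act (rev w) v = (\<lambda>y. \<Sum>x\<in>X. v x * act (rev w) (unit_vec x) y)"
    using act_sum[OF fin, of "rev w" "\<lambda>x y. v x * unit_vec x y"] by (simp add: act_scale)
  moreover have "act (rev w) v = unit_vec s" using w by (simp add: v_def)
  ultimately have sum: "unit_vec s y = (\<Sum>x\<in>X. v x * act (rev w) (unit_vec x) y)" for y
    by metis
  show ?thesis
  proof (rule root_sign_cases[OF w(1) s])
    assume "\<And>x. act w (unit_vec s) x \<le> 0"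
    then have "(\<Sum>x\<in>X. v x * act (rev w) (unit_vec x) s) \<le> 0"
      using w by (intro sum_nonpos mult_nonpos_nonneg) (auto simp: v_def)
    with sum[of s] show ?thesis by simp
  next
    assume nonneg: "\<And>x. 0 \<le> act w (unit_vec s) x"
    have "(\<Sum>x\<in>X. v x * act (rev w) (unit_vec x) s) \<noteq> 0" using sum[of s] by simp
    then obtain x where x: "x \<in> X" "v x * act (rev w) (unit_vec x) s \<noteq> 0"
      by (meson sum.not_neutral_contains_not_neutral)
    have "act (rev w) (unit_vec x) y = 0" if "y \<noteq> s" for y
    proof -
      have "(\<Sum>x\<in>X. v x * act (rev w) (unit_vec x) y) = 0" using sum[of y] that by simp
      then have "v x * act (rev w) (unit_vec x) y = 0"
        using fin nonneg w x by (subst (asm) sum_nonneg_eq_0_iff) (auto simp: v_def)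
      with x show ?thesis by auto
    qed
    then have "act (rev w) (unit_vec x) = unit_vec s"
      using w x X s by (intro nonneg_multiple_unit) auto
    then have "act w (unit_vec s) = unit_vec x" using act_act_rev[OF w(1)] by metis
    with x w show ?thesis by auto
  qed
qed

text \<open>A reflection in \<open>s\<close> changes only the coordinate at \<open>s\<close>. A
  nonnegative root that becomes nonpositive is therefore concentrated there, hence equal to the
  simple root of \<open>s\<close>, which \<open>not\<close> excludes.\<close>

lemma minimal_step:
  assumes f: "minimal X f" and X: "X \<subseteq> S" and s: "s \<in> S"
    and not: "\<not> (\<exists>x\<in>X. f (unit_vec s) = unit_vec x)"
  shows "minimal X (f \<circ> reflect s)"
proof -
  obtain w where w: "set w \<subseteq> S" "f = act w" "\<And>x y. x \<in> X \<Longrightarrow> 0 \<le> act (rev w) (unit_vec x) y"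
    using f by (auto simp: minimal_def)
  have "0 \<le> act (rev (w @ [s])) (unit_vec x) y" if x: "x \<in> X" for x y
  proof (rule root_sign_cases[of "rev (w @ [s])" x])
    assume neg: "\<And>y. act (rev (w @ [s])) (unit_vec x) y \<le> 0"
    have "act (rev w) (unit_vec x) y = 0" if "y \<noteq> s" for y
      using neg[of y] w(3)[OF x, of y] that by (simp add: act_Cons reflect_other)
    then have "act (rev w) (unit_vec x) = unit_vec s"
      using w x X s by (intro nonneg_multiple_unit) auto
    then have "act w (unit_vec s) = unit_vec x" using act_act_rev[OF w(1)] by metis
    with not x w show ?thesis by auto
  qed (use w s x X in auto)
  then show ?thesis unfolding minimal_def
    using w s by (intro exI[of _ "w @ [s]"]) (auto simp: act_append)
qed

text \<open>For the linear map f of w, the condition w s w^{-1} = x amounts to f(unit_vec s) = unit_vec x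
  as long as f is minimal. Signs of letters play no role: a letter that is kept leaves w
  unchanged.\<close>

fun ret :: "'s set \<Rightarrow> (('s \<Rightarrow> real) \<Rightarrow> 's \<Rightarrow> real) \<Rightarrow> 's word \<Rightarrow> 's word" where
  "ret X f [] = []"
| "ret X f ((s, b) # u) =
    (if \<exists>x\<in>X. f (unit_vec s) = unit_vec x
     then (THE x. f (unit_vec s) = unit_vec x, b) # ret X f u
     else ret X (f \<circ> reflect s) u)"

fun end_rep :: "'s set \<Rightarrow> (('s \<Rightarrow> real) \<Rightarrow> 's \<Rightarrow> real) \<Rightarrow> 's word
    \<Rightarrow> ('s \<Rightarrow> real) \<Rightarrow> 's \<Rightarrow> real" where
  "end_rep X f [] = f"
| "end_rep X f ((s, b) # u) =
    (if \<exists>x\<in>X. f (unit_vec s) = unit_vec x then end_rep X f u else end_rep X (f \<circ> reflect s) u)"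

section \<open>Formal properties of the reading\<close>

lemma ret_keep:
  "x \<in> X \<Longrightarrow> f (unit_vec s) = unit_vec x \<Longrightarrow> ret X f ((s, b) # u) = (x, b) # ret X f u"
  "x \<in> X \<Longrightarrow> f (unit_vec s) = unit_vec x \<Longrightarrow> end_rep X f ((s, b) # u) = end_rep X f u"
  by auto

lemma ret_append: "ret X f (u @ v) = ret X f u @ ret X (end_rep X f u) v"
  by (induction X f u rule: ret.induct) (auto simp: comp_def)

lemma end_rep_append: "end_rep X f (u @ v) = end_rep X (end_rep X f u) v"
  by (induction X f u rule: ret.induct) (auto simp: comp_def)

lemma minimal_end_rep:
  "minimal X f \<Longrightarrow> X \<subseteq> S \<Longrightarrow> u \<in> words S \<Longrightarrow> minimal X (end_rep X f u)"
  by (induction X f u rule: ret.induct) (auto simp: minimal_step)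

lemma ret_words:
  assumes "u \<in> words S"
  shows "ret X f u \<in> words X"
proof -
  have "(THE x. f (unit_vec s) = unit_vec x) \<in> X" if "\<exists>x\<in>X. f (unit_vec s) = unit_vec x" for f s
    using that by auto
  then show ?thesis by (induction X f u rule: ret.induct) auto
qed

text \<open>From the state \<open>id\<close> each letter of \<open>X\<close> is kept as itself and
  leaves the state at \<open>id\<close>.\<close>

lemma ret_prefix: "u \<in> words X \<Longrightarrow> ret X id (u @ v) = u @ ret X id v"
  by (induction u) auto

text \<open>The dropped letters form a word \<open>w\<close> in \<open>Y\<close>, which changes only
  coordinates in \<open>Y\<close>; a simple root that it produces from one in \<open>Y\<close> is
  again in \<open>Y\<close>.\<close>

lemma ret_words_Int:
  assumes "u \<in> words Y" "Y \<subseteq> S" "set w \<subseteq> Y"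
  shows "ret X (act w) u \<in> words (X \<inter> Y)"
  using assms
proof (induction u arbitrary: w)
  case (Cons a u)
  obtain s b where a: "a = (s, b)" by (cases a)
  have s: "s \<in> Y" using Cons a by simp
  show ?case
  proof (cases "\<exists>x\<in>X. act w (unit_vec s) = unit_vec x")
    case True
    then obtain x where x: "x \<in> X" "act w (unit_vec s) = unit_vec x" by blast
    have "x \<in> Y"
    proof (rule ccontr)
      assume "x \<notin> Y"
      then have "act w (unit_vec s) x = 0"
        using s Cons.prems by (subst act_other) (auto simp: unit_vec_def)
      then show False using x by simp
    qed
    then show ?thesis using Cons x by (simp add: a ret_keep)
  next
    case False
    have "ret X (act (w @ [s])) u \<in> words (X \<inter> Y)" using Cons s a by (intro Cons.IH) auto
    then show ?thesis using False by (simp add: a act_append)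
  qed
qed simp

section \<open>Squares, and words with at most one kept letter\<close>

lemma minimal_lin: "minimal X f \<Longrightarrow> f (\<lambda>x. a * u x + b * v x) = (\<lambda>x. a * f u x + b * f v x)"
  by (auto simp: minimal_def act_lin)

lemma supp_in_unit: "supp_in X (unit_vec x) \<longleftrightarrow> x \<in> X"
  by (auto simp: supp_in_def unit_vec_def)

lemma keep_iff_supp:
  "minimal X f \<Longrightarrow> X \<subseteq> S \<Longrightarrow> s \<in> S \<Longrightarrow>
    (\<exists>x\<in>X. f (unit_vec s) = unit_vec x) \<longleftrightarrow> supp_in X (f (unit_vec s))"
  using minimal_root_supp by (auto simp: supp_in_unit)

text \<open>Arbitrary signs cover both the square relation and the cancellation of a letter with its
  inverse. If the first letter is dropped, the tested root only changes its sign, so the second is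
  dropped too and the state is restored.\<close>

lemma ret_square:
  assumes f: "minimal X f" and X: "X \<subseteq> S" and s: "s \<in> S"
  shows "end_rep X f [(s, b), (s, b')] = f"
    and "ret X f [(s, b), (s, b')] = [] \<or>
      (\<exists>x\<in>X. f (unit_vec s) = unit_vec x \<and> ret X f [(s, b), (s, b')] = [(x, b), (x, b')])"
proof -
  have "end_rep X f [(s, b), (s, b')] = f \<and> (ret X f [(s, b), (s, b')] = [] \<or>
      (\<exists>x\<in>X. f (unit_vec s) = unit_vec x \<and> ret X f [(s, b), (s, b')] = [(x, b), (x, b')]))"
  proof (cases "\<exists>x\<in>X. f (unit_vec s) = unit_vec x")
    case True
    then obtain x where "x \<in> X" "f (unit_vec s) = unit_vec x" by blast
    then show ?thesis by (auto simp: ret_keep)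
  next
    case False
    have "\<not> supp_in X (f (unit_vec s))" using keep_iff_supp[OF f X s] False by simp
    moreover have "f (reflect s (unit_vec s)) = (\<lambda>x. - f (unit_vec s) x)"
      using minimal_lin[OF f, of "-1" "unit_vec s" 0 "unit_vec s"] by (simp add: reflect_self s)
    ultimately have "\<not> supp_in X ((f \<circ> reflect s) (unit_vec s))" by (simp add: supp_in_def)
    then have "\<not> (\<exists>x\<in>X. (f \<circ> reflect s) (unit_vec s) = unit_vec x)"
      by (auto simp: supp_in_unit)
    moreover have "f \<circ> reflect s \<circ> reflect s = f" using s by (simp add: fun_eq_iff)
    ultimately show ?thesis using False by simp
  qed
  then show "end_rep X f [(s, b), (s, b')] = f"
    and "ret X f [(s, b), (s, b')] = [] \<or>
      (\<exists>x\<in>X. f (unit_vec s) = unit_vec x \<and> ret X f [(s, b), (s, b')] = [(x, b), (x, b')])"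
    by blast+
qed

text \<open>As long as everything is dropped, the test at position \<open>j\<close> concerns the
  image under \<open>f\<close> of the root met there.\<close>

lemma ret_no_keep:
  assumes "minimal X f" "X \<subseteq> S" "set w \<subseteq> S"
    and "\<And>j. j < length w \<Longrightarrow> \<not> supp_in X (f (act (take j w) (unit_vec (w ! j))))"
  shows "ret X f (pos w) = [] \<and> end_rep X f (pos w) = f \<circ> act w"
  using assms
proof (induction w arbitrary: f)
  case (Cons s w)
  have no: "\<not> (\<exists>x\<in>X. f (unit_vec s) = unit_vec x)"
    using Cons.prems(4)[of 0] by (auto simp: supp_in_unit)
  have "ret X (f \<circ> reflect s) (pos w) = [] \<and> end_rep X (f \<circ> reflect s) (pos w) = f \<circ> reflect s \<circ> act w"
  proof (intro Cons.IH minimal_step)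
    fix j assume "j < length w"
    then show "\<not> supp_in X ((f \<circ> reflect s) (act (take j w) (unit_vec (w ! j))))"
      using Cons.prems(4)[of "Suc j"] by (simp add: act_Cons)
  qed (use Cons.prems no in auto)
  then show ?case using no by (auto simp: act_Cons fun_eq_iff)
qed simp

lemma supp_in_reflect: "x \<in> X \<Longrightarrow> supp_in X (reflect x v) \<longleftrightarrow> supp_in X v"
  by (auto simp: supp_in_def reflect_def unit_vec_def split: if_splits)

lemma minimal_conj:
  assumes "minimal X f" "X \<subseteq> S" "s \<in> S" "x \<in> X" "f (unit_vec s) = unit_vec x"
  shows "f (reflect s v) = reflect x (f v)"
proof -
  obtain w where "set w \<subseteq> S" "f = act w" using assms(1) by (auto simp: minimal_def)
  then show ?thesis using fun_cong[OF act_conj_refl[of w s x], of v] assms by simp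
qed

text \<open>A kept letter does not enter the state, so all later tests differ by the reflection in
  \<open>x\<close>, which preserves the span of \<open>X\<close> and hence their outcome. Up to this
  reflection the final state is \<open>f\<close> composed with the action of the whole word, a form
  that can be compared across a braid relation.\<close>

lemma ret_one_keep:
  assumes "minimal X f" "X \<subseteq> S" "set w \<subseteq> S" "i < length w"
    and "supp_in X (f (act (take i w) (unit_vec (w ! i))))"
    and "\<And>j. j < length w \<Longrightarrow> j \<noteq> i \<Longrightarrow> \<not> supp_in X (f (act (take j w) (unit_vec (w ! j))))"
  shows "\<exists>x\<in>X. f (act (take i w) (unit_vec (w ! i))) = unit_vec x \<and>
    ret X f (pos w) = [(x, True)] \<and> end_rep X f (pos w) = reflect x \<circ> f \<circ> act w"
  using assms
proof (induction w arbitrary: f i)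
  case (Cons s w)
  have s: "s \<in> S" and w: "set w \<subseteq> S" using Cons.prems by auto
  show ?case
  proof (cases i)
    case 0
    then obtain x where x: "x \<in> X" "f (unit_vec s) = unit_vec x"
      using Cons.prems(5) minimal_root_supp[OF Cons.prems(1,2) s] by auto
    note conj = minimal_conj[OF Cons.prems(1,2) s x]
    have "\<not> supp_in X (f (act (take j w) (unit_vec (w ! j))))" if "j < length w" for j
      using Cons.prems(6)[of "Suc j"] that by (simp add: 0 act_Cons conj supp_in_reflect x)
    then have "ret X f (pos w) = [] \<and> end_rep X f (pos w) = f \<circ> act w"
      using Cons.prems w by (intro ret_no_keep) auto
    then have "ret X f (pos (s # w)) = [(x, True)]" "end_rep X f (pos (s # w)) = f \<circ> act w"
      by (simp_all add: ret_keep[where f = f and s = s, OF x] del: ret.simps(2) end_rep.simps(2))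
    moreover have "f \<circ> act w = reflect x \<circ> f \<circ> act (s # w)"
      using x Cons.prems(2) by (auto simp: act_Cons conj fun_eq_iff)
    moreover have "f (act (take i (s # w)) (unit_vec ((s # w) ! i))) = unit_vec x"
      using x by (simp add: 0)
    ultimately show ?thesis using x(1) by metis
  next
    case (Suc i')
    have no: "\<not> (\<exists>x\<in>X. f (unit_vec s) = unit_vec x)"
      using Cons.prems(6)[of 0] Suc by (auto simp: supp_in_unit)
    have "\<exists>x\<in>X. (f \<circ> reflect s) (act (take i' w) (unit_vec (w ! i'))) = unit_vec x \<and>
      ret X (f \<circ> reflect s) (pos w) = [(x, True)] \<and>
      end_rep X (f \<circ> reflect s) (pos w) = reflect x \<circ> (f \<circ> reflect s) \<circ> act w"
    proof (intro Cons.IH minimal_step)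
      fix j assume "j < length w" "j \<noteq> i'"
      then show "\<not> supp_in X ((f \<circ> reflect s) (act (take j w) (unit_vec (w ! j))))"
        using Cons.prems(6)[of "Suc j"] Suc by (simp add: act_Cons)
    qed (use Cons.prems no s w Suc in \<open>auto simp: act_Cons\<close>)
    then show ?thesis using no by (auto simp: Suc act_Cons fun_eq_iff)
  qed
qed simp

section \<open>Reading the two sides of a braid relation\<close>

lemma ret_alt_keep_both:
  assumes "x \<in> X" "y \<in> X" "f (unit_vec s) = unit_vec x" "f (unit_vec t) = unit_vec y"
  shows "ret X f (pos (alt k s t)) = pos (alt k x y) \<and> end_rep X f (pos (alt k s t)) = f"
  using assms by (induction k arbitrary: s t x y) (auto simp: ret_keep)

lemma dihedral_root_image:
  assumes "minimal X f" "s \<in> S" "t \<in> S" "j < k"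
  shows "f (act (take j (alt k s t)) (unit_vec (alt k s t ! j))) =
    (\<lambda>x. cheb (mcos s t) (Suc j) * f (unit_vec s) x + cheb (mcos s t) j * f (unit_vec t) x)"
proof -
  have "act (take j (alt k s t)) (unit_vec (alt k s t ! j)) =
    act (alt j s t) (unit_vec (if even j then s else t))"
    using assms by (simp add: take_alt nth_alt)
  then show ?thesis
    by (simp only: act_alt_unit[OF assms(2,3)] minimal_lin[OF assms(1)])
qed

text \<open>The two sides of a braid relation meet the same \<open>k\<close> positive roots in
  opposite order; in coordinates this is the symmetry of the Chebyshev numbers under
  \<open>n\<close> to \<open>k - n\<close>.\<close>

lemma dihedral_root_reverse:
  assumes "minimal X f" "s \<in> S" "t \<in> S" "s \<noteq> t" "m s t = enat k" "j < k"
  shows "f (act (take (k - 1 - j) (alt k t s)) (unit_vec (alt k t s ! (k - 1 - j)))) =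
    f (act (take j (alt k s t)) (unit_vec (alt k s t ! j)))"
proof -
  have k: "2 \<le> k" and c: "mcos s t = cos (pi / k)"
    using m_enat_ge_2 assms by (auto simp: mcos_def)
  have j: "Suc (k - 1 - j) = k - j" "k - 1 - j = k - Suc j" "k - Suc j < k"
    using assms by auto
  show ?thesis
    unfolding dihedral_root_image[OF assms(1-3,6)] j(2)
    using dihedral_root_image[OF assms(1,3,2) j(3)] j
      cheb_pi_div_symmetric[of k j] cheb_pi_div_symmetric[of k "Suc j"] k assms(2,3,6)
    by (simp add: c mcos_sym[of t s] add.commute)
qed

text \<open>Two different roots form a basis of the plane by \<open>cheb_det\<close>, so if their
  images lie in the span of \<open>X\<close>, the images of both simple roots do.\<close>

lemma dihedral_root_two_supp:
  assumes f: "minimal X f" and S: "s \<in> S" "t \<in> S" "s \<noteq> t" "m s t = enat k" and ij: "i < j" "j < k"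
    and supp: "supp_in X (f (act (take i (alt k s t)) (unit_vec (alt k s t ! i))))"
      "supp_in X (f (act (take j (alt k s t)) (unit_vec (alt k s t ! j))))"
  shows "supp_in X (f (unit_vec s))" "supp_in X (f (unit_vec t))"
proof -
  have k: "2 \<le> k" and c: "mcos s t = cos (pi / k)"
    using m_enat_ge_2 S by (auto simp: mcos_def)
  define U where "U = cheb (mcos s t)"
  have det: "U (Suc i) * U j - U i * U (Suc j) \<noteq> 0"
  proof -
    have "0 < j - i" "j - i < k" using ij by auto
    then have "0 < cheb (mcos s t) (j - i)" using cheb_pi_div_pos[OF k] by (simp add: c)
    then show ?thesis using cheb_det[of "mcos s t" i "j - i"] ij by (simp add: U_def)
  qed
  have "f (unit_vec s) y = 0 \<and> f (unit_vec t) y = 0" if y: "y \<notin> X" for y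
  proof -
    define a b where "a = f (unit_vec s) y" and "b = f (unit_vec t) y"
    have i: "U (Suc i) * a + U i * b = 0" and j: "U (Suc j) * a + U j * b = 0"
      using supp y ij dihedral_root_image[OF f S(1,2)] by (auto simp: supp_in_def U_def a_def b_def)
    have "(U (Suc i) * U j - U i * U (Suc j)) * a =
        U j * (U (Suc i) * a + U i * b) - U i * (U (Suc j) * a + U j * b)"
      "(U (Suc i) * U j - U i * U (Suc j)) * b =
        U (Suc i) * (U (Suc j) * a + U j * b) - U (Suc j) * (U (Suc i) * a + U i * b)"
      by (simp_all add: algebra_simps)
    then have "a = 0" "b = 0" unfolding i j using det by simp_all
    then show ?thesis by (simp add: a_def b_def)
  qed
  then show "supp_in X (f (unit_vec s))" "supp_in X (f (unit_vec t))" by (auto simp: supp_in_def)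
qed

text \<open>Labels can be recovered from the form, because cosine is injective on the interval from
  0 to pi and the label \<infinity> corresponds to the angle 0.\<close>

lemma enat_eq_if_mcos_eq:
  assumes cos: "mcos s t = mcos x y" and ge: "2 \<le> m s t" "2 \<le> m x y" and k: "m s t = enat k"
  shows "m x y = enat k"
proof -
  have k2: "2 \<le> k" using ge(1) unfolding k numeral_eq_enat by simp
  have bounds: "0 < pi / n" "pi / n \<le> pi" if "2 \<le> n" for n :: nat
    using that by (simp_all add: divide_simps)
  show ?thesis
  proof (cases "m x y")
    case (enat l)
    then have l2: "2 \<le> l" using ge(2) unfolding enat numeral_eq_enat by simp
    have eq: "cos (pi / k) = cos (pi / l)" using cos by (simp add: mcos_def k enat)
    have "pi / k = pi / l"
      by (rule cos_inj_pi[OF _ _ _ _ eq]) (use bounds[OF k2] bounds[OF l2] in auto)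
    then show ?thesis using enat k2 l2 by simp
  next
    case infinity
    then have "cos (pi / k) = 1" using cos by (simp add: mcos_def k)
    moreover have "cos (pi / k) < cos 0"
      using bounds[OF k2] by (intro cos_monotone_0_pi) auto
    ultimately show ?thesis by simp
  qed
qed

text \<open>Of the \<open>k\<close> dihedral roots, all, exactly one or none are sent into the span
  of \<open>X\<close>. In the first case the form, and with it the label, is preserved, so the
  outputs are the two sides of a braid relation. In the second case both sides keep one letter, and
  it is the same one since both met the same root. In the last case both outputs are empty.\<close>

lemma ret_braid:
  assumes f: "minimal X f" and X: "X \<subseteq> S" and st: "s \<in> S" "t \<in> S" "s \<noteq> t" "m s t = enat k"
  shows "end_rep X f (pos (alt k s t)) = end_rep X f (pos (alt k t s))"
    and "ret X f (pos (alt k s t)) = ret X f (pos (alt k t s)) \<or>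
      (ret X f (pos (alt k s t)), ret X f (pos (alt k t s))) \<in> artin_relations X m"
proof -
  have ts: "t \<in> S" "s \<in> S" "t \<noteq> s" "m t s = enat k" using st m_sym by auto
  have Sst: "set (alt k s t) \<subseteq> S" "set (alt k t s) \<subseteq> S"
    using set_alt[of k s t] set_alt[of k t s] st by auto
  let ?E = "\<lambda>s t j. supp_in X (f (act (take j (alt k s t)) (unit_vec (alt k s t ! j))))"
  have rev: "?E t s (k - 1 - j) \<longleftrightarrow> ?E s t j" if "j < k" for j
    using dihedral_root_reverse[OF f st that] by simp
  have rev': "k - 1 - (k - 1 - j) = j" if "j < k" for j using that by simp
  have "end_rep X f (pos (alt k s t)) = end_rep X f (pos (alt k t s)) \<and>
    (ret X f (pos (alt k s t)) = ret X f (pos (alt k t s)) \<or>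
      (ret X f (pos (alt k s t)), ret X f (pos (alt k t s))) \<in> artin_relations X m)"
  proof (cases "supp_in X (f (unit_vec s)) \<and> supp_in X (f (unit_vec t))")
    case True
    then obtain x y where xy: "x \<in> X" "y \<in> X" "f (unit_vec s) = unit_vec x" "f (unit_vec t) = unit_vec y"
      using minimal_root_supp[OF f X st(1)] minimal_root_supp[OF f X st(2)] by blast
    obtain w where w: "set w \<subseteq> S" "f = act w" using f by (auto simp: minimal_def)
    have "x \<noteq> y"
    proof
      assume "x = y"
      then have "act (rev w) (f (unit_vec s)) = act (rev w) (f (unit_vec t))" using xy by simp
      then show False using w st by simp
    qed
    have "form (unit_vec x) (unit_vec y) = form (unit_vec s) (unit_vec t)"
      unfolding xy(3,4)[symmetric] w(2) by (rule form_act[OF w(1)])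
    then have "mcos s t = mcos x y" using st xy X by (simp add: form_unit subset_iff)
    moreover have "2 \<le> m s t" "2 \<le> m x y"
      using m_ge_2[OF st(1-3)] m_ge_2[of x y] xy(1,2) X \<open>x \<noteq> y\<close> by blast+
    ultimately have "m x y = enat k" using st(4) by (rule enat_eq_if_mcos_eq)
    then have "(pos (alt k x y), pos (alt k y x)) \<in> artin_relations X m"
      using xy \<open>x \<noteq> y\<close> unfolding artin_relations_def by blast
    then show ?thesis
      using ret_alt_keep_both[OF xy] ret_alt_keep_both[OF xy(2,1,4,3)] by simp
  next
    case not_both: False
    show ?thesis
    proof (cases "\<exists>i<k. ?E s t i")
      case True
      then obtain i where i: "i < k" "?E s t i" by blast
      have other: "\<not> ?E s t j" if "j < k" "j \<noteq> i" for j
        using dihedral_root_two_supp[OF f st] not_both i that by (metis linorder_neq_iff)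
      have other': "\<not> ?E t s j" if "j < k" "j \<noteq> k - 1 - i" for j
        using other[of "k - 1 - j"] rev[of "k - 1 - j"] that i by auto
      obtain x where x: "x \<in> X" "f (act (take i (alt k s t)) (unit_vec (alt k s t ! i))) = unit_vec x"
        "ret X f (pos (alt k s t)) = [(x, True)]"
        "end_rep X f (pos (alt k s t)) = reflect x \<circ> f \<circ> act (alt k s t)"
        using ret_one_keep[OF f X Sst(1), of i] i other by auto
      obtain y where y: "y \<in> X"
        "f (act (take (k - 1 - i) (alt k t s)) (unit_vec (alt k t s ! (k - 1 - i)))) = unit_vec y"
        "ret X f (pos (alt k t s)) = [(y, True)]"
        "end_rep X f (pos (alt k t s)) = reflect y \<circ> f \<circ> act (alt k t s)"
        using ret_one_keep[OF f X Sst(2), of "k - 1 - i"] i other' rev[OF i(1)] by auto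
      have "y = x"
        using dihedral_root_reverse[OF f st i(1)] unfolding y(2) x(2) by simp
      then show ?thesis using x(3,4) y(3,4) act_braid[OF st] by simp
    next
      case False
      have "\<not> ?E t s j" if "j < k" for j
        using False rev[of "k - 1 - j"] that by auto
      then have "ret X f (pos (alt k t s)) = [] \<and> end_rep X f (pos (alt k t s)) = f \<circ> act (alt k t s)"
        by (intro ret_no_keep[OF f X Sst(2)]) auto
      moreover have
        "ret X f (pos (alt k s t)) = [] \<and> end_rep X f (pos (alt k s t)) = f \<circ> act (alt k s t)"
        using False by (intro ret_no_keep[OF f X Sst(1)]) auto
      ultimately show ?thesis using act_braid[OF st] by simp
    qed
  qed
  then show "end_rep X f (pos (alt k s t)) = end_rep X f (pos (alt k t s))"
    and "ret X f (pos (alt k s t)) = ret X f (pos (alt k t s)) \<or>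
      (ret X f (pos (alt k s t)), ret X f (pos (alt k t s))) \<in> artin_relations X m"
    by blast+
qed

lemma artin_relations_mono:
  assumes "X \<subseteq> S"
  shows "artin_relations X m \<subseteq> artin_relations S m"
proof
  fix r assume "r \<in> artin_relations X m"
  then obtain x y k where "r = (pos (alt k x y), pos (alt k y x))" "x \<in> X" "y \<in> X" "x \<noteq> y" "m x y = enat k"
    unfolding artin_relations_def by blast
  moreover have "x \<in> S" "y \<in> S" using assms \<open>x \<in> X\<close> \<open>y \<in> X\<close> by blast+
  ultimately show "r \<in> artin_relations S m" unfolding artin_relations_def by blast
qed

text \<open>Generators joined by an odd edge are conjugate, so a square relation for one of them is a
  square relation for the other.\<close>

lemma ret_cong:
  assumes p: "\<And>s. s \<in> S \<Longrightarrow> p s = 2 \<or> p s = \<infinity>"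
    and odd: "\<And>s t k. \<lbrakk>s \<in> S; t \<in> S; m s t = enat k; odd k\<rbrakk> \<Longrightarrow> p s = p t"
    and X: "X \<subseteq> S" and uv: "(u, v) \<in> word_cong S (shephard_relations S p m)" and f: "minimal X f"
  shows "end_rep X f u = end_rep X f v"
    and "(ret X f u, ret X f v) \<in> word_cong S (shephard_relations S p m)"
proof -
  let ?R = "shephard_relations S p m"
  have mono: "words X \<subseteq> words S" using X by (auto simp: words_def)
  have words: "ret X f u \<in> words S" if "u \<in> words S" for f u using ret_words[OF that] mono by auto
  \<comment> \<open>Both claims go into one induction over all states: in the context rule the
    replaced subword is read from the state after \<open>q\<close>, and \<open>r\<close> is read
    from the state it leaves behind.\<close>
  have "end_rep X f u = end_rep X f v \<and> (ret X f u, ret X f v) \<in> word_cong S ?R"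
    using uv f
  proof (induction arbitrary: f)
    case (rel u v)
    then consider s where "s \<in> S" "p s = 2" "u = [(s, True), (s, True)]" "v = []" |
      s t k where "s \<in> S" "t \<in> S" "s \<noteq> t" "m s t = enat k" "u = pos (alt k s t)" "v = pos (alt k t s)"
    proof -
      from rel(1) consider s k where "s \<in> S" "p s = enat k" "u = pos (replicate k s)" "v = []" |
        s t k where "s \<in> S" "t \<in> S" "s \<noteq> t" "m s t = enat k" "u = pos (alt k s t)" "v = pos (alt k t s)"
        by (auto simp: shephard_relations_def artin_relations_def)
      then show ?thesis
      proof cases
        case (1 s k)
        then have "k = 2" "p s = 2" using p[of s] by (auto simp: numeral_eq_enat)
        then show ?thesis using 1 that(1)[of s] by (simp add: numeral_2_eq_2)
      qed (use that(2) in blast)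
    qed
    then show ?case
    proof cases
      case (1 s)
      have "(ret X f u, ret X f v) \<in> word_cong S ?R" if x: "x \<in> X" "f (unit_vec s) = unit_vec x"
        "ret X f u = [(x, True), (x, True)]" for x
      proof -
        obtain w where w: "set w \<subseteq> S" "f = act w" using rel.prems by (auto simp: minimal_def)
        have "p s = p x"
        proof (rule root_image_const)
          show "act w (unit_vec s) = unit_vec x" "x \<in> S" using x w X by auto
        qed (use odd w 1 in blast)+
        then have "p x = enat (Suc (Suc 0))" using 1 by (simp add: numeral_eq_enat numeral_2_eq_2)
        then have "(pos (replicate (Suc (Suc 0)) x), []) \<in> ?R"
          using x X unfolding shephard_relations_def by blast
        then have "([(x, True), (x, True)], []) \<in> ?R" by simp
        moreover have "x \<in> S" using x(1) X by blast
        ultimately have "([(x, True), (x, True)], []) \<in> word_cong S ?R"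
          by (intro word_cong.rel) simp_all
        then show ?thesis unfolding x(3) 1(4) by simp
      qed
      then show ?thesis
        using ret_square[OF rel.prems X, of s True True] 1 word_cong.refl[of "[]" S ?R]
        by (auto simp del: ret.simps(2) end_rep.simps(2))
    next
      case (2 s t k)
      note braid = ret_braid[OF rel.prems X 2(1-4), folded 2(5,6)]
      have "(ret X f u, ret X f v) \<in> word_cong S ?R"
        using braid(2)
      proof
        assume "ret X f u = ret X f v"
        then show ?thesis using words rel.hyps by (simp add: word_cong.refl)
      next
        assume "(ret X f u, ret X f v) \<in> artin_relations X m"
        then have "(ret X f u, ret X f v) \<in> ?R"
          using artin_relations_mono[OF X] unfolding shephard_relations_def by blast
        then show ?thesis using words rel.hyps by (intro word_cong.rel)
      qed
      with braid(1) show ?thesis by blast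
    qed
  next
    case (cancel s b)
    have "([(x, b), (x, \<not> b)], []) \<in> word_cong S ?R" if "x \<in> X" for x
      using that X by (intro word_cong.cancel) auto
    moreover have "([], []) \<in> word_cong S ?R" by (simp add: word_cong.refl)
    ultimately show ?case
      using ret_square[OF cancel.prems X cancel.hyps, of b "\<not> b"]
      by (auto simp del: ret.simps(2) end_rep.simps(2))
  next
    case (refl w)
    then show ?case by (auto intro: word_cong.refl words)
  next
    case (ctxt u v q r)
    have "minimal X (end_rep X f q)" using ctxt X by (intro minimal_end_rep)
    note IH = ctxt.IH[OF this]
    show ?case
      unfolding ret_append end_rep_append using IH words ctxt.hyps
      by (simp add: word_cong.ctxt)
  next
    case (sym u v)
    from sym.IH[OF sym.prems] show ?case by (simp add: word_cong.sym)
  next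
    case (trans u v w)
    from trans.IH(1)[OF trans.prems] trans.IH(2)[OF trans.prems] show ?case
      by (auto intro: word_cong.trans)
  qed
  then show "end_rep X f u = end_rep X f v" "(ret X f u, ret X f v) \<in> word_cong S ?R"
    by blast+
qed

end


section \<open>Families of subgroups with retractions\<close>

text \<open>This isolates what the coset arguments use: \<open>proj K\<close> is equivariant under
  left multiplication by \<open>H K\<close> and respects the family, but it is not assumed to be a
  homomorphism.\<close>

locale retractive_family = group G for G (structure) +
  fixes S :: "'s set" and H :: "'s set \<Rightarrow> 'a set" and proj :: "'s set \<Rightarrow> 'a \<Rightarrow> 'a"
  assumes sub: "K \<subseteq> S \<Longrightarrow> subgroup (H K) G"
    and mono: "K \<subseteq> L \<Longrightarrow> L \<subseteq> S \<Longrightarrow> H K \<subseteq> H L"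
    and proj_mult: "K \<subseteq> S \<Longrightarrow> a \<in> H K \<Longrightarrow> g \<in> carrier G \<Longrightarrow> proj K (a \<otimes> g) = a \<otimes> proj K g"
    and proj_in: "K \<subseteq> S \<Longrightarrow> L \<subseteq> S \<Longrightarrow> g \<in> H L \<Longrightarrow> proj K g \<in> H (K \<inter> L)"
begin

lemma carr: "K \<subseteq> S \<Longrightarrow> g \<in> H K \<Longrightarrow> g \<in> carrier G"
  using subgroup.mem_carrier[OF sub] by blast

lemma mult_mem: "K \<subseteq> S \<Longrightarrow> g \<in> H K \<Longrightarrow> h \<in> H K \<Longrightarrow> g \<otimes> h \<in> H K"
  and inv_mem: "K \<subseteq> S \<Longrightarrow> g \<in> H K \<Longrightarrow> inv g \<in> H K"
  and one_mem: "K \<subseteq> S \<Longrightarrow> \<one> \<in> H K"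
  using sub by (auto simp: subgroup.m_closed subgroup.m_inv_closed subgroup.one_closed)

text \<open>Project l = (l p) p^{-1} to \<open>H K\<close> in two ways: the left side lands in
  \<open>H (K \<inter> L)\<close>, and on the right the factor l p comes out by equivariance,
  leaving the projection of p^{-1} in \<open>H (K \<inter> P)\<close>.\<close>

lemma mem_product_Int:
  assumes K: "K \<subseteq> S" and L: "L \<subseteq> S" and P: "P \<subseteq> S"
    and l: "l \<in> H L" and p: "p \<in> H P" and lp: "l \<otimes> p \<in> H K"
  obtains a b where "a \<in> H (K \<inter> L)" "b \<in> H (K \<inter> P)" "l \<otimes> p = a \<otimes> b"
proof
  note c = carr[OF L l] carr[OF P p]
  have l': "proj K l \<in> H (K \<inter> L)" and p': "proj K (inv p) \<in> H (K \<inter> P)"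
    using proj_in K L P l inv_mem[OF P p] by auto
  have KP: "K \<inter> P \<subseteq> S" and KL: "K \<inter> L \<subseteq> S" using K by auto
  show "inv (proj K (inv p)) \<in> H (K \<inter> P)" using inv_mem[OF KP p'] .
  have "l = (l \<otimes> p) \<otimes> inv p" using c by (simp add: m_assoc)
  then have "proj K l = (l \<otimes> p) \<otimes> proj K (inv p)" using proj_mult[OF K lp, of "inv p"] c by simp
  moreover have "proj K (inv p) \<in> carrier G" using carr[OF KP p'] .
  ultimately show "l \<otimes> p = proj K l \<otimes> inv (proj K (inv p))"
    using c by (simp add: m_assoc)
  show "proj K l \<in> H (K \<inter> L)" by fact
qed

text \<open>The case of a trivial second factor, with \<open>P = {}\<close>.\<close>

lemma Int_eq:
  assumes K: "K \<subseteq> S" and L: "L \<subseteq> S"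
  shows "H K \<inter> H L = H (K \<inter> L)"
proof
  show "H (K \<inter> L) \<subseteq> H K \<inter> H L" using mono K L by auto
  show "H K \<inter> H L \<subseteq> H (K \<inter> L)"
  proof
    fix g assume g: "g \<in> H K \<inter> H L"
    then have "g \<otimes> \<one> \<in> H K" using carr[OF K] by simp
    then obtain a b where ab: "a \<in> H (K \<inter> L)" "b \<in> H (K \<inter> {})" "g \<otimes> \<one> = a \<otimes> b"
      using mem_product_Int[OF K L _ _ one_mem, of "{}" g] g by auto
    have "b \<in> H (K \<inter> L)" using ab(2) mono[of "{}" "K \<inter> L"] K by auto
    then have "a \<otimes> b \<in> H (K \<inter> L)" using ab(1) K by (intro mult_mem) auto
    then show "g \<in> H (K \<inter> L)" using ab(3) g carr[OF K] by simp
  qed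
qed

text \<open>If \<open>l\<close> and \<open>p\<close> lie in the same left coset of
  \<open>H K\<close>, that coset meets \<open>H L \<inter> H P\<close>: with l^{-1} p = a b, the
  point l a equals p b^{-1}.\<close>

lemma translate_into_Int:
  assumes K: "K \<subseteq> S" and L: "L \<subseteq> S" and P: "P \<subseteq> S"
    and l: "l \<in> H L" and p: "p \<in> H P" and lp: "inv l \<otimes> p \<in> H K"
  obtains a where "a \<in> H K" "l \<otimes> a \<in> H L \<inter> H P"
proof -
  note c = carr[OF L l] carr[OF P p]
  have KP: "K \<inter> P \<subseteq> S" and KL: "K \<inter> L \<subseteq> S" using K by auto
  obtain a b where a: "a \<in> H (K \<inter> L)" and b: "b \<in> H (K \<inter> P)" and ab: "inv l \<otimes> p = a \<otimes> b"
    using mem_product_Int[OF K L P inv_mem[OF L l] p lp] by metis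
  have c': "a \<in> carrier G" "b \<in> carrier G" using carr[OF KL a] carr[OF KP b] .
  have "a \<in> H K" "a \<in> H L" "b \<in> H P" using a b mono K L P by blast+
  moreover have "l \<otimes> a = p \<otimes> inv b"
  proof -
    have "l \<otimes> a = l \<otimes> (a \<otimes> b) \<otimes> inv b" using c c' by (simp add: m_assoc)
    also have "l \<otimes> (a \<otimes> b) = p" using c c' unfolding ab[symmetric] by (simp add: m_assoc[symmetric])
    finally show ?thesis .
  qed
  ultimately have "l \<otimes> a \<in> H L \<inter> H P" using mult_mem inv_mem L P l p by (metis IntI)
  then show ?thesis using that \<open>a \<in> H K\<close> by blast
qed

lemma set_mult_Int:
  assumes K: "K \<subseteq> S" and L: "L \<subseteq> S" and P: "P \<subseteq> S"
  shows "(H K <#> H L) \<inter> (H K <#> H P) = H K <#> (H L \<inter> H P)"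
proof
  show "H K <#> (H L \<inter> H P) \<subseteq> (H K <#> H L) \<inter> (H K <#> H P)" by (auto simp: set_mult_def)
  show "(H K <#> H L) \<inter> (H K <#> H P) \<subseteq> H K <#> (H L \<inter> H P)"
  proof
    fix g assume "g \<in> (H K <#> H L) \<inter> (H K <#> H P)"
    then obtain k l k' p where k: "k \<in> H K" "k' \<in> H K" and l: "l \<in> H L" and p: "p \<in> H P"
      and g: "g = k \<otimes> l" "g = k' \<otimes> p" by (auto simp: set_mult_def)
    note c = carr[OF K k(1)] carr[OF K k(2)] carr[OF L l] carr[OF P p]
    \<comment> \<open>The equation k l = k' p places l^{-1} and p^{-1} in one left coset of
      \<open>H K\<close>; hence the inverses.\<close>
    have "inv (inv l) \<otimes> inv p = inv k \<otimes> k'"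
    proof -
      have "inv k \<otimes> k' = inv k \<otimes> (k' \<otimes> p) \<otimes> inv p" using c by (simp add: m_assoc)
      also have "\<dots> = inv k \<otimes> (k \<otimes> l) \<otimes> inv p" using g by simp
      also have "inv k \<otimes> (k \<otimes> l) = l" using c by (simp add: m_assoc[symmetric])
      finally show ?thesis using c by simp
    qed
    then have "inv (inv l) \<otimes> inv p \<in> H K" using k K by (simp add: mult_mem inv_mem)
    then obtain a where a: "a \<in> H K" "inv l \<otimes> a \<in> H L \<inter> H P"
      using translate_into_Int[OF K L P inv_mem[OF L l] inv_mem[OF P p]] by blast
    have ac: "a \<in> carrier G" using carr[OF K a(1)] .
    have "k \<otimes> a \<in> H K" using mult_mem[OF K k(1) a(1)] .
    moreover have "inv (inv l \<otimes> a) \<in> H L \<inter> H P" using a inv_mem L P by auto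
    moreover have "g = (k \<otimes> a) \<otimes> inv (inv l \<otimes> a)"
    proof -
      have "inv (inv l \<otimes> a) = inv a \<otimes> l" using c ac by (simp add: inv_mult_group)
      moreover have "a \<otimes> (inv a \<otimes> l) = l" using c ac by (simp add: m_assoc[symmetric])
      ultimately show ?thesis using c ac g by (simp add: m_assoc)
    qed
    ultimately show "g \<in> H K <#> (H L \<inter> H P)" unfolding set_mult_def by blast
  qed
qed

section \<open>Cosets and their Helly property\<close>

lemma coset_mem_iff:
  assumes "K \<subseteq> S" "g \<in> carrier G" "h \<in> carrier G"
  shows "h \<in> g <# H K \<longleftrightarrow> inv g \<otimes> h \<in> H K"
proof
  assume "h \<in> g <# H K"
  then obtain k where k: "k \<in> H K" "h = g \<otimes> k" by (auto simp: l_coset_def)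
  then have "inv g \<otimes> h = k" using assms carr[OF assms(1) k(1)] by (simp add: m_assoc[symmetric])
  then show "inv g \<otimes> h \<in> H K" using k by simp
next
  assume k: "inv g \<otimes> h \<in> H K"
  have "h = g \<otimes> (inv g \<otimes> h)" using assms by (simp add: m_assoc[symmetric])
  with k show "h \<in> g <# H K" unfolding l_coset_def by blast
qed

lemma coset_carrier: "K \<subseteq> S \<Longrightarrow> g \<in> carrier G \<Longrightarrow> g <# H K \<subseteq> carrier G"
  using l_coset_subset_G subgroup.subset[OF sub] by blast

lemma coset_eq: "K \<subseteq> S \<Longrightarrow> g \<in> carrier G \<Longrightarrow> h \<in> g <# H K \<Longrightarrow> g <# H K = h <# H K"
  using l_repr_independence sub by blast

definition cosets :: "'a set set" where
  "cosets = {g <# H K | g K. g \<in> carrier G \<and> K \<subseteq> S}"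

lemma cosets_carrier: "A \<in> cosets \<Longrightarrow> A \<subseteq> carrier G"
  using coset_carrier by (auto simp: cosets_def)

lemma cosets_repr: "A \<in> cosets \<Longrightarrow> z \<in> A \<Longrightarrow> \<exists>K\<subseteq>S. A = z <# H K"
  using coset_eq by (auto simp: cosets_def)

lemma cosets_Int:
  assumes "A \<in> cosets" "B \<in> cosets" "A \<inter> B \<noteq> {}"
  shows "A \<inter> B \<in> cosets"
proof -
  obtain z where z: "z \<in> A" "z \<in> B" using assms by auto
  have zc: "z \<in> carrier G" using z cosets_carrier assms by auto
  obtain K where K: "K \<subseteq> S" "A = z <# H K" using cosets_repr[OF assms(1) z(1)] by blast
  obtain L where L: "L \<subseteq> S" "B = z <# H L" using cosets_repr[OF assms(2) z(2)] by blast
  have "(z <# H K) \<inter> (z <# H L) = z <# (H K \<inter> H L)"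
    using zc carr[OF K(1)] carr[OF L(1)] by (auto simp: l_coset_def)
  then have "A \<inter> B = z <# H (K \<inter> L)" using K L Int_eq by simp
  then show ?thesis using zc K(1) unfolding cosets_def by blast
qed

text \<open>After translating a common point of B and C to 1, the coset A is l H K = p H K with l in H L
  and p in H P.\<close>

lemma cosets_helly3:
  assumes "A \<in> cosets" "B \<in> cosets" "C \<in> cosets" "A \<inter> B \<noteq> {}" "A \<inter> C \<noteq> {}" "B \<inter> C \<noteq> {}"
  shows "A \<inter> B \<inter> C \<noteq> {}"
proof -
  obtain z where z: "z \<in> B" "z \<in> C" using assms by auto
  have zc: "z \<in> carrier G" using z cosets_carrier assms by auto
  obtain L where L: "L \<subseteq> S" "B = z <# H L" using cosets_repr[OF assms(2) z(1)] by blast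
  obtain P where P: "P \<subseteq> S" "C = z <# H P" using cosets_repr[OF assms(3) z(2)] by blast
  obtain l where l: "l \<in> H L" "z \<otimes> l \<in> A" using assms(4) L by (auto simp: l_coset_def)
  obtain p where p: "p \<in> H P" "z \<otimes> p \<in> A" using assms(5) P by (auto simp: l_coset_def)
  note c = carr[OF L(1) l(1)] carr[OF P(1) p(1)]
  obtain K where K: "K \<subseteq> S" "A = (z \<otimes> l) <# H K" using cosets_repr[OF assms(1) l(2)] by blast
  have "inv (z \<otimes> l) \<otimes> (z \<otimes> p) \<in> H K"
    using coset_mem_iff[OF K(1), of "z \<otimes> l" "z \<otimes> p"] p(2) K(2) zc c by simp
  moreover have "inv z \<otimes> (z \<otimes> p) = p" using zc c by (simp add: m_assoc[symmetric])
  ultimately have "inv l \<otimes> p \<in> H K" using zc c by (simp add: inv_mult_group m_assoc)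
  then obtain a where a: "a \<in> H K" "l \<otimes> a \<in> H L \<inter> H P"
    using translate_into_Int[OF K(1) L(1) P(1) l(1) p(1)] by blast
  have "z \<otimes> (l \<otimes> a) \<in> B" "z \<otimes> (l \<otimes> a) \<in> C"
    unfolding L(2) P(2) l_coset_def using a(2) by blast+
  moreover have "z \<otimes> (l \<otimes> a) = (z \<otimes> l) \<otimes> a" using zc c carr[OF K(1) a(1)] by (simp add: m_assoc)
  then have "z \<otimes> (l \<otimes> a) \<in> A" unfolding K(2) l_coset_def using a(1) by blast
  ultimately have "z \<otimes> (l \<otimes> a) \<in> A \<inter> B \<inter> C" by blast
  then show ?thesis by blast
qed

text \<open>One member of \<open>F\<close> at a time is absorbed into \<open>A\<close>, which stays
  a coset; the case of three cosets keeps it meeting all the others.\<close>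

lemma cosets_helly:
  assumes "finite F" "F \<subseteq> cosets" "A \<in> cosets"
    and "\<And>B. B \<in> F \<Longrightarrow> A \<inter> B \<noteq> {}" "\<And>B C. B \<in> F \<Longrightarrow> C \<in> F \<Longrightarrow> B \<inter> C \<noteq> {}"
  shows "A \<inter> \<Inter>F \<noteq> {}"
  using assms
proof (induction F arbitrary: A rule: finite_induct)
  case empty
  then show ?case using subgroup.one_closed[OF sub] by (auto simp: cosets_def l_coset_def)
next
  case (insert B F)
  have "A \<inter> B \<inter> \<Inter>F \<noteq> {}"
  proof (rule insert.IH)
    show "A \<inter> B \<in> cosets" using insert.prems by (intro cosets_Int) auto
    show "A \<inter> B \<inter> C \<noteq> {}" if "C \<in> F" for C
      using insert.prems that by (intro cosets_helly3) auto
  qed (use insert.prems in auto)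
  then show ?case by (simp add: Int_assoc)
qed

lemma flag_coset_complex:
  fixes I :: "'i set"
  assumes I: "finite I" and K: "\<And>i. i \<in> I \<Longrightarrow> K i \<subseteq> S"
  shows "flag_complex (coset_complex G I (\<lambda>i. H (K i)))" (is "flag_complex ?C")
  unfolding flag_complex_def
proof (intro conjI allI impI)
  show "abstract_complex ?C"
    unfolding abstract_complex_def coset_complex_def
  proof (intro conjI ballI allI impI)
    show "{} \<in> {\<sigma>. finite \<sigma> \<and> \<sigma> \<subseteq> coset_vertices G I (\<lambda>i. H (K i)) \<and>
        carrier G \<inter> (\<Inter>v\<in>\<sigma>. snd v) \<noteq> {}}"
      using one_closed by blast
    fix \<sigma> \<tau> :: "('i \<times> 'a set) set"
    assume \<sigma>: "\<sigma> \<in> {\<sigma>. finite \<sigma> \<and> \<sigma> \<subseteq> coset_vertices G I (\<lambda>i. H (K i)) \<and>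
        carrier G \<inter> (\<Inter>v\<in>\<sigma>. snd v) \<noteq> {}}"
    then show "finite \<sigma>" by blast
    assume "\<tau> \<subseteq> \<sigma>"
    with \<sigma> show "\<tau> \<in> {\<sigma>. finite \<sigma> \<and> \<sigma> \<subseteq> coset_vertices G I (\<lambda>i. H (K i)) \<and>
        carrier G \<inter> (\<Inter>v\<in>\<sigma>. snd v) \<noteq> {}}"
      by (blast intro: finite_subset)
  qed
  fix \<sigma> assume sub: "\<sigma> \<subseteq> \<Union> ?C" and edges: "\<forall>u\<in>\<sigma>. \<forall>v\<in>\<sigma>. u \<noteq> v \<longrightarrow> {u, v} \<in> ?C"
  have vert: "\<sigma> \<subseteq> coset_vertices G I (\<lambda>i. H (K i))" using sub by (auto simp: coset_complex_def)
  have cos: "snd v \<in> cosets" "fst v \<in> I" "\<exists>g\<in>carrier G. snd v = g <# H (K (fst v))" if "v \<in> \<sigma>" for v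
  proof -
    obtain i g where "v = (i, g <# H (K i))" "i \<in> I" "g \<in> carrier G"
      using vert \<open>v \<in> \<sigma>\<close> unfolding coset_vertices_def by blast
    then show "snd v \<in> cosets" "fst v \<in> I" "\<exists>g\<in>carrier G. snd v = g <# H (K (fst v))"
      using K unfolding cosets_def by auto
  qed
  have nonempty: "A \<noteq> {}" if "A \<in> cosets" for A
    using that one_mem by (auto simp: cosets_def l_coset_def)
  have meet: "snd u \<inter> snd v \<noteq> {}" if "u \<in> \<sigma>" "v \<in> \<sigma>" for u v
  proof (cases "u = v")
    case False
    then have "{u, v} \<in> ?C" using edges that by blast
    then show ?thesis by (auto simp: coset_complex_def)
  qed (use that cos nonempty in auto)
  \<comment> \<open>The flag condition allows infinite vertex sets. Cosets of one type that meet are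
    equal, so \<sigma> has at most one vertex of each type.\<close>
  have "inj_on fst \<sigma>"
  proof (rule inj_onI)
    fix u v assume uv: "u \<in> \<sigma>" "v \<in> \<sigma>" "fst u = fst v"
    obtain z where z: "z \<in> snd u" "z \<in> snd v" using meet[OF uv(1,2)] by blast
    have "snd u = z <# H (K (fst u))" "snd v = z <# H (K (fst v))"
      using cos[OF uv(1)] cos[OF uv(2)] z K coset_eq by metis+
    then show "u = v" using uv(3) by (simp add: prod_eq_iff)
  qed
  moreover have "fst ` \<sigma> \<subseteq> I" using cos by auto
  ultimately have fin: "finite \<sigma>" using I by (meson finite_subset finite_imageD)
  have "carrier G \<inter> (\<Inter>v\<in>\<sigma>. snd v) \<noteq> {}"
  proof (cases "\<sigma> = {}")
    case False
    then obtain u where u: "u \<in> \<sigma>" by blast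
    have "snd u \<inter> \<Inter>(snd ` \<sigma>) \<noteq> {}"
    proof (rule cosets_helly)
      show "snd ` \<sigma> \<subseteq> cosets" "snd u \<in> cosets" using cos(1) u by blast+
      show "snd u \<inter> B \<noteq> {}" if "B \<in> snd ` \<sigma>" for B using meet[OF u] that by blast
      show "B \<inter> C \<noteq> {}" if "B \<in> snd ` \<sigma>" "C \<in> snd ` \<sigma>" for B C using meet that by blast
    qed (use fin in simp)
    then show ?thesis using cosets_carrier cos(1)[OF u] by blast
  next
    case True
    then show ?thesis using one_closed by blast
  qed
  then show "\<sigma> \<in> ?C" using fin vert by (simp add: coset_complex_def)
qed

end


section \<open>Presented groups\<close>

abbreviation wclass :: "'s set \<Rightarrow> ('s word \<times> 's word) set \<Rightarrow> 's word \<Rightarrow> 's word set" where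
  "wclass S R u \<equiv> word_cong S R `` {u}"

lemma carrier_presented_group: "carrier (presented_group S R) = wclass S R ` words S"
  by (auto simp: presented_group_def quotient_def)

lemma one_presented_group: "\<one>\<^bsub>presented_group S R\<^esub> = wclass S R []"
  by (simp add: presented_group_def)

lemma wclass_eqI: "(u, v) \<in> word_cong S R \<Longrightarrow> wclass S R u = wclass S R v"
  by (rule equiv_class_eq[OF equiv_word_cong])

lemma inv_presented_group:
  assumes "u \<in> words S"
  shows "inv\<^bsub>presented_group S R\<^esub> (wclass S R u) = wclass S R (word_inv u)"
proof (rule group.inv_equality[OF group_presented_group])
  show "wclass S R (word_inv u) \<otimes>\<^bsub>presented_group S R\<^esub> wclass S R u = \<one>\<^bsub>presented_group S R\<^esub>"
    using assms by (simp add: presented_group_mult one_presented_group wclass_eqI word_inv_cancel)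
qed (use assms in \<open>auto simp: carrier_presented_group\<close>)

lemma words_mono: "K \<subseteq> L \<Longrightarrow> u \<in> words K \<Longrightarrow> u \<in> words L"
  by (auto simp: words_def)

text \<open>This lets the retraction, which works on words, be applied to generated
  subgroups.\<close>

lemma subgroup_gen_eq:
  assumes K: "K \<subseteq> S"
  shows "subgroup_gen S R K = wclass S R ` words K"
proof
  note subS = words_mono[OF K]
  show "subgroup_gen S R K \<subseteq> wclass S R ` words K"
  proof
    fix g assume "g \<in> subgroup_gen S R K"
    then have "g \<in> generate (presented_group S R) (gen S R ` K)" by (simp add: subgroup_gen_def)
    then show "g \<in> wclass S R ` words K"
    proof induction
      case one
      show ?case by (simp add: one_presented_group)
    next
      case (incl h)
      then show ?case by (auto simp: gen_def)
    next
      case (inv h)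
      then obtain x where x: "x \<in> K" "h = wclass S R [(x, True)]" by (auto simp: gen_def)
      then have "inv\<^bsub>presented_group S R\<^esub> h = wclass S R (word_inv [(x, True)])"
        using K by (simp add: inv_presented_group subset_iff)
      then show ?case using x by simp
    next
      case (eng g h)
      then obtain u v where "u \<in> words K" "v \<in> words K" "g = wclass S R u" "h = wclass S R v"
        by blast
      then show ?case using subS by (intro image_eqI[of _ _ "u @ v"]) (auto simp: presented_group_mult)
    qed
  qed
  have "wclass S R u \<in> generate (presented_group S R) (gen S R ` K)" if "u \<in> words K" for u
    using that
  proof (induction u)
    case Nil
    then show ?case using generate.one by (metis one_presented_group)
  next
    case (Cons a u)
    obtain x b where a: "a = (x, b)" by (cases a)
    have x: "x \<in> K" "x \<in> S" and u: "u \<in> words K" using Cons.prems a K by auto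
    have "wclass S R [a] \<in> generate (presented_group S R) (gen S R ` K)"
    proof (cases b)
      case True
      then show ?thesis using x a by (auto simp: gen_def intro!: generate.incl)
    next
      case False
      have "inv\<^bsub>presented_group S R\<^esub> (gen S R x) = wclass S R [a]"
        using x False by (simp add: a gen_def inv_presented_group word_inv_def)
      then show ?thesis using generate.inv[of "gen S R x" "gen S R ` K" "presented_group S R"] x by simp
    qed
    moreover have "wclass S R (a # u) = wclass S R [a] \<otimes>\<^bsub>presented_group S R\<^esub> wclass S R u"
      using subS[OF u] x a by (simp add: presented_group_mult)
    ultimately show ?case using Cons.IH[OF u] generate.eng by metis
  qed
  then show "wclass S R ` words K \<subseteq> subgroup_gen S R K" by (auto simp: subgroup_gen_def)
qed

lemma subgroup_subgroup_gen:
  "K \<subseteq> S \<Longrightarrow> subgroup (subgroup_gen S R K) (presented_group S R)"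
  unfolding subgroup_gen_def
  by (rule group.generate_is_subgroup[OF group_presented_group])
    (auto simp: carrier_presented_group gen_def)

lemma (in coxeter_system) retractive_family_shephard:
  assumes p: "\<And>s. s \<in> S \<Longrightarrow> p s = 2 \<or> p s = \<infinity>"
    and odd: "\<And>s t k. \<lbrakk>s \<in> S; t \<in> S; m s t = enat k; odd k\<rbrakk> \<Longrightarrow> p s = p t"
  defines "R \<equiv> shephard_relations S p m"
  shows "\<exists>proj. retractive_family (presented_group S R) S (subgroup_gen S R) proj"
proof -
  let ?G = "presented_group S R"
  \<comment> \<open>The representative is arbitrary; \<open>ret_cong\<close> makes the result
    independent of it.\<close>
  define proj where "proj X g = wclass S R (ret X id (SOME u. u \<in> g))" for X g
  have proj: "proj X (wclass S R u) = wclass S R (ret X id u)" if X: "X \<subseteq> S" and u: "u \<in> words S" for X u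
  proof -
    have "u \<in> wclass S R u" using u by (auto intro: word_cong.refl)
    then have "(SOME v. v \<in> wclass S R u) \<in> wclass S R u" by (rule someI)
    then have "(u, SOME v. v \<in> wclass S R u) \<in> word_cong S R" by blast
    then have "(ret X id u, ret X id (SOME v. v \<in> wclass S R u)) \<in> word_cong S R"
      using ret_cong(2)[OF p odd X _ minimal_id] by (simp add: R_def)
    then show ?thesis unfolding proj_def by (rule wclass_eqI[symmetric])
  qed
  have "retractive_family ?G S (subgroup_gen S R) proj"
  proof (intro retractive_family.intro retractive_family_axioms.intro group_presented_group)
    fix K L assume L: "L \<subseteq> S"
    show "subgroup (subgroup_gen S R L) ?G" using L by (rule subgroup_subgroup_gen)
    show "subgroup_gen S R K \<subseteq> subgroup_gen S R L" if "K \<subseteq> L"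
      using that L words_mono[OF that] by (auto simp: subgroup_gen_eq[of _ S])
    show "proj L (a \<otimes>\<^bsub>?G\<^esub> g) = a \<otimes>\<^bsub>?G\<^esub> proj L g"
      if ag: "a \<in> subgroup_gen S R L" "g \<in> carrier ?G" for a g
    proof -
      obtain u v where "u \<in> words L" "v \<in> words S" "a = wclass S R u" "g = wclass S R v"
        using ag unfolding subgroup_gen_eq[OF L] carrier_presented_group by blast
      then show ?thesis
        using words_mono[OF L] ret_words[of v L]
        by (simp add: proj L presented_group_mult ret_prefix)
    qed
    show "proj K g \<in> subgroup_gen S R (K \<inter> L)" if K: "K \<subseteq> S" and g: "g \<in> subgroup_gen S R L" for g
    proof -
      obtain u where "u \<in> words L" "g = wclass S R u" using g unfolding subgroup_gen_eq[OF L] by blast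
      moreover have "K \<inter> L \<subseteq> S" using L by auto
      ultimately show ?thesis
        using ret_words_Int[of u L "[]" K] L K words_mono[OF L]
        by (auto simp: proj subgroup_gen_eq)
    qed
  qed
  then show ?thesis by blast
qed

section \<open>The free product as one Shephard group\<close>

lemma coxeter_matrix_sum:
  "coxeter_matrix S m \<Longrightarrow> coxeter_matrix S' m' \<Longrightarrow> coxeter_matrix (S <+> S') (sum_matrix m m')"
  unfolding coxeter_matrix_def by (auto simp: sum_matrix_def) blast+

theorem corollary5p5:
  fixes S\<^sub>A :: "'a set" and S\<^sub>B :: "'b set"
    and m\<^sub>A :: "'a \<Rightarrow> 'a \<Rightarrow> enat" and m\<^sub>B :: "'b \<Rightarrow> 'b \<Rightarrow> enat"
    and R\<^sub>A :: "('a word \<times> 'a word) set" and R\<^sub>B :: "('b word \<times> 'b word) set"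
  assumes "finite S\<^sub>A" and "finite S\<^sub>B"
    and "coxeter_matrix S\<^sub>A m\<^sub>A" and "coxeter_matrix S\<^sub>B m\<^sub>B"
    and "R\<^sub>A = artin_relations S\<^sub>A m\<^sub>A \<or> R\<^sub>A = coxeter_relations S\<^sub>A m\<^sub>A"
    and "R\<^sub>B = artin_relations S\<^sub>B m\<^sub>B \<or> R\<^sub>B = coxeter_relations S\<^sub>B m\<^sub>B"
  defines "S \<equiv> S\<^sub>A <+> S\<^sub>B"
  defines "R \<equiv> free_product_relations R\<^sub>A R\<^sub>B"
  defines "G \<equiv> presented_group S R"
  defines "I \<equiv> {1..card S}"
  shows "(\<forall>K L P. K \<subseteq> S \<and> L \<subseteq> S \<and> P \<subseteq> S \<longrightarrow>
      subgroup_gen S R K \<inter> subgroup_gen S R L = subgroup_gen S R (K \<inter> L) \<and>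
      (subgroup_gen S R K <#>\<^bsub>G\<^esub> subgroup_gen S R L) \<inter>
        (subgroup_gen S R K <#>\<^bsub>G\<^esub> subgroup_gen S R P) =
        subgroup_gen S R K <#>\<^bsub>G\<^esub> (subgroup_gen S R L \<inter> subgroup_gen S R P)) \<and>
    (\<forall>s. bij_betw s I S \<longrightarrow>
      flag_complex (coset_complex G I (\<lambda>i. subgroup_gen S R (s ` (I - {i})))))"
proof -
  obtain p\<^sub>A :: enat where pA: "p\<^sub>A = 2 \<or> p\<^sub>A = \<infinity>"
    "R\<^sub>A = artin_relations S\<^sub>A m\<^sub>A \<and> (\<lambda>_ :: 'a. p\<^sub>A) = (\<lambda>_. \<infinity>) \<or>
      R\<^sub>A = coxeter_relations S\<^sub>A m\<^sub>A \<and> (\<lambda>_ :: 'a. p\<^sub>A) = (\<lambda>_. 2)"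
    using assms(5) by metis
  obtain p\<^sub>B :: enat where pB: "p\<^sub>B = 2 \<or> p\<^sub>B = \<infinity>"
    "R\<^sub>B = artin_relations S\<^sub>B m\<^sub>B \<and> (\<lambda>_ :: 'b. p\<^sub>B) = (\<lambda>_. \<infinity>) \<or>
      R\<^sub>B = coxeter_relations S\<^sub>B m\<^sub>B \<and> (\<lambda>_ :: 'b. p\<^sub>B) = (\<lambda>_. 2)"
    using assms(6) by metis
  define p :: "'a + 'b \<Rightarrow> enat" where "p = case_sum (\<lambda>_. p\<^sub>A) (\<lambda>_. p\<^sub>B)"
  define m where "m = sum_matrix m\<^sub>A m\<^sub>B"
  define Q where "Q = shephard_relations S p m"
  have "finite S" using assms by (simp add: S_def)
  interpret coxeter_system S m
    using assms coxeter_matrix_sum by unfold_locales (simp_all add: S_def m_def)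
  have G: "G = presented_group S Q" "gen S R = gen S Q"
    using free_product_is_shephard[OF assms(3,4) pA(2) pB(2)]
    unfolding G_def Q_def S_def R_def p_def m_def by simp_all
  have gens: "subgroup_gen S R = subgroup_gen S Q"
    using G by (simp add: subgroup_gen_def fun_eq_iff G_def)
  have p_values: "p s = 2 \<or> p s = \<infinity>" for s using pA(1) pB(1) by (cases s) (auto simp: p_def)
  \<comment> \<open>A finite label occurs only inside one factor, where all generators have the same
    order; this covers the odd labels.\<close>
  have p_edge: "p s = p t" if "m s t = enat k" for s t k
    using that by (cases s; cases t) (auto simp: p_def m_def sum_matrix_def)
  have "\<exists>proj. retractive_family G S (subgroup_gen S R) proj"
    unfolding gens G(1) Q_def
    by (rule retractive_family_shephard) (simp only: p_values, erule p_edge)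
  then obtain proj where "retractive_family G S (subgroup_gen S R) proj" ..
  then interpret retractive_family G S "subgroup_gen S R" proj .
  show ?thesis
  proof (intro conjI allI impI; (elim conjE)?)
    fix K L P assume K: "K \<subseteq> S" and L: "L \<subseteq> S" and P: "P \<subseteq> S"
    show "subgroup_gen S R K \<inter> subgroup_gen S R L = subgroup_gen S R (K \<inter> L)"
      and "(subgroup_gen S R K <#>\<^bsub>G\<^esub> subgroup_gen S R L) \<inter>
        (subgroup_gen S R K <#>\<^bsub>G\<^esub> subgroup_gen S R P) =
        subgroup_gen S R K <#>\<^bsub>G\<^esub> (subgroup_gen S R L \<inter> subgroup_gen S R P)"
      by (rule Int_eq[OF K L]) (rule set_mult_Int[OF K L P])
  next
    fix s assume "bij_betw s I S"
    then have "s ` I = S" by (simp add: bij_betw_def)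
    then show "flag_complex (coset_complex G I (\<lambda>i. subgroup_gen S R (s ` (I - {i}))))"
      by (intro flag_coset_complex) (auto simp: I_def)
  qed
qed

end
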